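(* Let $n\in\{2,3\}$. The only infinitesimal symmetries of the form $$x\mapsto x+\varepsilon\,\xi(u,p,x),\qquad (u,p)\mapsto(u,p)+\varepsilon\,\eta(u,p,x),$$ i.e. generated by $X=\xi\cdot\nabla_x+\eta\cdot\nabla_{(u,p)}$ with smooth $\xi$ (with values in $\mathbb{R}^n$) and $\eta$ (with values in $\mathbb{R}^{n+1}$), which leave the homogeneous Navier-Stokes equations $$\Delta u-\nabla p=u\cdot\nabla u,\qquad\nabla\cdot u=0$$ in $\mathbb{R}^n$ invariant are (up to linear combinations of the generators): 1. the translations $x\mapsto x+\delta$, $\delta\in\mathbb{R}^n$, with generator $X=\frac{\delta}{|\delta|}\cdot\nabla_x$; 2. the rotations $u(x)\mapsto\mathbf{R}^{-1}u(\mathbf{R}x)$, $p(x)\mapsto p(\mathbf{R}x)$, $\mathbf{R}\in\mathrm{SO}(n)$, whose $n(n-1)/2$ generators are given in terms of the Lie algebra $\mathfrak{so}(n)$ (for $n=2$: $X=x^\perp\cdot\nabla_x+u^\perp\cdot\nabla_u$); 3. the scaling symmetry $u(x)\mapsto e^\lambda u(e^\lambda x)$, $p(x)\mapsto e^{2\lambda}p(e^\lambda x)$, $\lambda\in\mathbb{R}$, which corresponds to $X=x\cdot\nabla_x-u\cdot\nabla_u-2p\,\partial_p$; 4. the addition of a constant to the pressure $p\mapsto p+c$, $c\in\mathbb{R}$, which corresponds to $X=\partial_p$.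
   Context: Here $u:\mathbb{R}^n\to\mathbb{R}^n$, $p:\mathbb{R}^n\to\mathbb{R}$, and $x^\perp=(-x_2,x_1)$ for $n=2$. Write $v=(u,p)$ and $L=(\Delta u-\nabla p-u\cdot\nabla u,\ \nabla\cdot u)$. The second extension of $X$ is $X_2=\xi\cdot\nabla_x+\sum_{|\alpha|\le2}\eta^\alpha\cdot\nabla_{D^\alpha v}$, where $\eta^{0}=\eta$ and $\eta^{(\alpha,\beta)}=\frac{d\eta^\beta}{dx_\alpha}-\frac{d\xi}{dx_\alpha}\cdot\nabla D^\beta v$ for $|\alpha|=1$ ($d/dx_\alpha$ denoting total derivatives). The vector field $X$ is an infinitesimal symmetry of the Navier-Stokes equations if $X_2L=0$ whenever $L=0$. Generators are identified up to the orientation of the group parameter. *)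

theory Defs
  imports "HOL-Analysis.Analysis" "HOL-Library.Function_Algebras"
begin

section \<open>Smooth maps\<close>

text \<open>
  \<open>Ck k f\<close>: all iterated directional derivatives of \<open>f\<close> up to order \<open>k\<close> exist and are
  continuous; on Euclidean spaces this is the class of \<open>k\<close> times continuously differentiable
  maps.
\<close>

fun Ck :: "nat \<Rightarrow> ('a::real_normed_vector \<Rightarrow> 'b::real_normed_vector) \<Rightarrow> bool" where
  "Ck 0 f \<longleftrightarrow> continuous_on UNIV f"
| "Ck (Suc k) f \<longleftrightarrow>
     (\<forall>z. f differentiable (at z)) \<and> (\<forall>h. Ck k (\<lambda>z. frechet_derivative f (at z) h))"

definition smooth :: "('a::real_normed_vector \<Rightarrow> 'b::real_normed_vector) \<Rightarrow> bool" where
  "smooth f \<longleftrightarrow> (\<forall>k. Ck k f)"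


section \<open>Jets and vector fields\<close>

text \<open>
  A value of \<open>v = (u, p)\<close>; points \<open>(x, v)\<close> with \<open>v = (u, p)\<close>; and jets \<open>(x, v, v1)\<close>,
  \<open>(x, v, v1, v2)\<close>, where \<open>v1 $ i\<close> is the coordinate \<open>D\<^sub>i v\<close> and \<open>v2 $ i $ j\<close> is the coordinate
  \<open>D\<^sub>i D\<^sub>j v\<close>.  The type of 2-jets carries both entries \<open>(i,j)\<close> and \<open>(j,i)\<close>; the actual 2-jets are
  those with symmetric second-order part, see \<open>is_jet\<close>.
\<close>

type_synonym 'n vp = "(real, 'n) vec \<times> real"
type_synonym 'n point = "(real, 'n) vec \<times> 'n vp"
type_synonym 'n jet1 = "(real, 'n) vec \<times> 'n vp \<times> ('n vp, 'n) vec"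
type_synonym 'n jet2 = "(real, 'n) vec \<times> 'n vp \<times> ('n vp, 'n) vec \<times> (('n vp, 'n) vec, 'n) vec"

definition is_jet :: "'n::finite jet2 \<Rightarrow> bool" where
  "is_jet z \<longleftrightarrow> (case z of (x, v, v1, v2) \<Rightarrow> \<forall>i j. v2 $ i $ j = v2 $ j $ i)"

text \<open>
  The vector field \<open>\<xi> \<cdot> \<nabla>\<^sub>x + \<eta> \<cdot> \<nabla>\<^sub>v\<close> is represented by its coefficients \<open>z \<mapsto> (\<xi> z, \<eta> z)\<close>.
\<close>

type_synonym 'n vfield = "'n point \<Rightarrow> 'n point"

definition \<xi> :: "'n::finite vfield \<Rightarrow> 'n point \<Rightarrow> real^'n" where
  "\<xi> X z = fst (X z)"

definition \<eta> :: "'n::finite vfield \<Rightarrow> 'n point \<Rightarrow> 'n vp" where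
  "\<eta> X z = snd (X z)"

text \<open>
  Total derivatives \<open>d/dx\<^sub>i = \<partial>/\<partial>x\<^sub>i + \<Sum>\<^sub>\<beta> D\<^sub>i D\<^sup>\<beta> v \<cdot> \<nabla>\<close> (the gradient taken in the variable \<open>D\<^sup>\<beta> v\<close>)
  of functions on points and on 1-jets, i.e. the derivative in the
  direction \<open>(e\<^sub>i, D\<^sub>i v)\<close> and \<open>(e\<^sub>i, D\<^sub>i v, (D\<^sub>i D\<^sub>j v)\<^sub>j)\<close>, respectively.
\<close>

definition total_deriv0 ::
  "'n::finite \<Rightarrow> ('n point \<Rightarrow> 'b::real_normed_vector) \<Rightarrow> 'n jet1 \<Rightarrow> 'b" where
  "total_deriv0 i F = (\<lambda>(x, v, v1). frechet_derivative F (at (x, v)) (axis i 1, v1 $ i))"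

definition total_deriv1 ::
  "'n::finite \<Rightarrow> ('n jet1 \<Rightarrow> 'b::real_normed_vector) \<Rightarrow> 'n jet2 \<Rightarrow> 'b" where
  "total_deriv1 i F =
     (\<lambda>(x, v, v1, v2). frechet_derivative F (at (x, v, v1)) (axis i 1, v1 $ i, v2 $ i))"

definition \<eta>1 :: "'n::finite vfield \<Rightarrow> 'n \<Rightarrow> 'n jet1 \<Rightarrow> 'n vp" where
  "\<eta>1 X i = (\<lambda>(x, v, v1).
     total_deriv0 i (\<eta> X) (x, v, v1)
     - (\<Sum>k\<in>UNIV. total_deriv0 i (\<xi> X) (x, v, v1) $ k *\<^sub>R v1 $ k))"

definition \<eta>2 :: "'n::finite vfield \<Rightarrow> 'n \<Rightarrow> 'n \<Rightarrow> 'n jet2 \<Rightarrow> 'n vp" where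
  "\<eta>2 X i j = (\<lambda>(x, v, v1, v2).
     total_deriv1 i (\<eta>1 X j) (x, v, v1, v2)
     - (\<Sum>k\<in>UNIV. total_deriv0 i (\<xi> X) (x, v, v1) $ k *\<^sub>R v2 $ k $ j))"

text \<open>
  Coefficients of the second extension, and its action on functions of the 2-jet as a
  first-order differential operator (derivative in the direction of the coefficients).
  Since \<open>\<eta>2\<close> is symmetric in \<open>i, j\<close> on symmetric jets, this is tangent to the space of
  actual 2-jets and each mixed derivative coordinate is effectively counted once.
\<close>

definition extension2 :: "'n::finite vfield \<Rightarrow> 'n jet2 \<Rightarrow> 'n jet2" where
  "extension2 X = (\<lambda>(x, v, v1, v2).
     (\<xi> X (x, v), \<eta> X (x, v), (\<chi> i. \<eta>1 X i (x, v, v1)), (\<chi> i j. \<eta>2 X i j (x, v, v1, v2))))"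

definition apply_extension2 ::
  "'n::finite vfield \<Rightarrow> ('n jet2 \<Rightarrow> 'b::real_normed_vector) \<Rightarrow> 'n jet2 \<Rightarrow> 'b" where
  "apply_extension2 X F z = frechet_derivative F (at z) (extension2 X z)"


section \<open>The Navier-Stokes equations and their infinitesimal symmetries\<close>

definition NS :: "'n::finite jet2 \<Rightarrow> (real^'n) \<times> real" where
  "NS = (\<lambda>(x, (u, p), v1, v2).
     ((\<Sum>i\<in>UNIV. fst (v2 $ i $ i)) - (\<chi> i. snd (v1 $ i)) - (\<Sum>i\<in>UNIV. u $ i *\<^sub>R fst (v1 $ i)),
      (\<Sum>i\<in>UNIV. fst (v1 $ i) $ i)))"

definition NS_symmetry :: "'n::finite vfield \<Rightarrow> bool" where
  "NS_symmetry X \<longleftrightarrow> (\<forall>z. is_jet z \<longrightarrow> NS z = 0 \<longrightarrow> apply_extension2 X NS z = 0)"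


section \<open>Linear combinations of vector fields\<close>

definition vf_scale :: "real \<Rightarrow> 'n::finite vfield \<Rightarrow> 'n vfield" where
  "vf_scale c X = (\<lambda>z. c *\<^sub>R X z)"

interpretation vf: vector_space "vf_scale :: real \<Rightarrow> 'n::finite vfield \<Rightarrow> 'n vfield"
  by unfold_locales (auto simp: vf_scale_def fun_eq_iff scaleR_add_left scaleR_add_right)


section \<open>The generators\<close>

definition translation_gen :: "real^'n::finite \<Rightarrow> 'n vfield" where
  "translation_gen \<delta> = (\<lambda>(x, u, p). (\<delta> /\<^sub>R norm \<delta>, 0, 0))"

definition so :: "(real^'n^'n::finite) set" where
  "so = {A. transpose A = - A}"

definition rotation_gen :: "real^'n^'n::finite \<Rightarrow> 'n vfield" where
  "rotation_gen A = (\<lambda>(x, u, p). (A *v x, A *v u, 0))"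

definition scaling_gen :: "'n::finite vfield" where
  "scaling_gen = (\<lambda>(x, u, p). (x, - u, - 2 * p))"

definition pressure_gen :: "'n::finite vfield" where
  "pressure_gen = (\<lambda>(x, u, p). (0, 0, 1))"

text \<open>
  \<open>x\<^sup>\<bottom> = (-x\<^sub>2, x\<^sub>1)\<close>, where the two elements \<open>a, b\<close> of the index type play the roles of \<open>1, 2\<close>.
\<close>

definition perp :: "'n::finite \<Rightarrow> 'n \<Rightarrow> real^'n \<Rightarrow> real^'n" where
  "perp a b x = (\<chi> k. if k = a then - (x $ b) else x $ a)"

definition perp_gen :: "'n::finite \<Rightarrow> 'n \<Rightarrow> 'n vfield" where
  "perp_gen a b = (\<lambda>(x, u, p). (perp a b x, perp a b u, 0))"


section \<open>The transformations of fields and their generators\<close>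

type_synonym 'n vpfield = "(real, 'n) vec \<Rightarrow> 'n vp"

definition translate :: "real^'n::finite \<Rightarrow> 'n vpfield \<Rightarrow> 'n vpfield" where
  "translate \<delta> f = (\<lambda>x. f (x + \<delta>))"

definition rotate_field :: "real^'n^'n::finite \<Rightarrow> 'n vpfield \<Rightarrow> 'n vpfield" where
  "rotate_field R f = (\<lambda>x. (matrix_inv R *v fst (f (R *v x)), snd (f (R *v x))))"

definition scale_field :: "real \<Rightarrow> 'n::finite vpfield \<Rightarrow> 'n vpfield" where
  "scale_field l f =
     (\<lambda>x. (exp l *\<^sub>R fst (f (exp l *\<^sub>R x)), exp (2 * l) * snd (f (exp l *\<^sub>R x))))"

definition shift_pressure :: "real \<Rightarrow> 'n::finite vpfield \<Rightarrow> 'n vpfield" where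
  "shift_pressure c f = (\<lambda>x. (fst (f x), snd (f x) + c))"

text \<open>
  The point transformation \<open>g\<close> of \<open>(x, u, p)\<close>-space induces the transformation \<open>T\<close> of fields if
  it maps the graph of every field \<open>f\<close> onto the graph of \<open>T f\<close>.
\<close>

definition induces :: "('n::finite point \<Rightarrow> 'n point) \<Rightarrow> ('n vpfield \<Rightarrow> 'n vpfield) \<Rightarrow> bool" where
  "induces g T \<longleftrightarrow> bij g \<and> (\<forall>f. range (\<lambda>x. (x, T f x)) = g ` range (\<lambda>x. (x, f x)))"

text \<open>
  \<open>X\<close> generates the one-parameter group \<open>T\<close> of transformations of fields, up to the orientation
  \<open>t \<mapsto> -t\<close> of the group parameter.
\<close>

definition generates ::
  "'n::finite vfield \<Rightarrow> (real \<Rightarrow> 'n vpfield \<Rightarrow> 'n vpfield) \<Rightarrow> bool" where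
  "generates X T \<longleftrightarrow>
     (\<forall>s t. T (s + t) = T s \<circ> T t) \<and>
     (\<exists>g. (\<forall>t. induces (g t) (T t)) \<and>
          ((\<forall>z. ((\<lambda>t. g t z) has_vector_derivative X z) (at 0)) \<or>
           (\<forall>z. ((\<lambda>t. g t z) has_vector_derivative - X z) (at 0))))"

end

theory Submission
  imports Defs
begin

text \<open>
  Write \<open>X = \<xi> \<cdot> \<nabla>\<^sub>x + f \<cdot> \<nabla>\<^sub>u + g \<partial>\<^sub>p\<close>.  The condition \<open>X\<^sub>2 NS = 0\<close> on \<open>NS = 0\<close> is a polynomial identity in
  the first and second derivatives of \<open>(u, p)\<close>, subject to \<open>\<Delta> u = \<nabla> p + u \<cdot> \<nabla> u\<close> and \<open>\<nabla> \<cdot> u = 0\<close>, and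
  the classification reads off its coefficients; only two independent directions are needed for this.

  The trace-free part of the Hessian of \<open>u\<close> is free.  Its coefficients say that the total derivative
  of \<open>\<xi>\<close> is conformal for every trace-free gradient of \<open>u\<close>, so that \<open>\<xi>\<close> depends on \<open>x\<close> only
  (\<open>k_vertical\<close>) and is conformal with a factor \<open>\<sigma> x\<close> (\<open>Z_conformal\<close>).  The divergence
  condition says that \<open>f\<^sub>u - \<xi>\<^sub>x\<close> is a multiple of the identity; a map of \<open>\<real>\<^sup>n\<close> with such a derivative
  has a constant multiple, whence \<open>f = \<xi>\<^sub>x u + L(x) u + c(x)\<close> (\<open>f_form\<close>).

  What remains of the momentum condition (\<open>momentum_condition\<close>) splits by degree in the first
  derivatives.  Degree one in \<open>\<nabla> p\<close> gives \<open>g\<^sub>p = L\<close> (\<open>g_pressure\<close>); then the only term of degree zero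
  that contains \<open>p\<close> is \<open>p \<nabla> L\<close>, so \<open>L\<close> is constant (\<open>L_const\<close>).  Among the terms of degree one in
  \<open>\<nabla> u\<close>, the convective term \<open>u \<cdot> \<nabla> u\<close> has the coefficient \<open>2 \<sigma> + L\<close> up to sign, so
  \<open>\<sigma> = - L / 2\<close> is constant, too (\<open>\<sigma>_const\<close>).  This excludes the conformal maps other than
  similarities, also in the plane: \<open>\<xi> - \<sigma> x\<close> is a Killing field, hence affine (\<open>killing_affine\<close>).
  Now the Laplacian of \<open>\<xi>\<close> and the mixed second derivatives of \<open>f\<close> vanish, and the same identities
  give \<open>c = 0\<close>, \<open>g\<^sub>u = 0\<close> and \<open>g\<^sub>x = 0\<close> (\<open>symmetry_form\<close>).  That these fields are symmetries is a
  direct computation (\<open>sim_gen_symmetry\<close>).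

  For the groups, a point transformation is determined by the transformation of fields that it
  induces (\<open>induces_unique\<close>), and every skew matrix \<open>A\<close> of size two or three generates rotations by
  Rodrigues' formula, because \<open>A\<^sup>3\<close> is a multiple of \<open>A\<close> (\<open>skew_cube\<close>).
\<close>

section \<open>Derivatives\<close>

text \<open>\<open>D1 F z h\<close> is the derivative of \<open>F\<close> at \<open>z\<close> in the direction \<open>h\<close>, and \<open>D2 F z h k\<close> is the
  derivative of \<open>y \<mapsto> D1 F y k\<close> at \<open>z\<close> in the direction \<open>h\<close>.  The symmetry of \<open>D2 F z\<close> is nowhere
  needed.\<close>

definition D1 :: "('a::real_normed_vector \<Rightarrow> 'b::real_normed_vector) \<Rightarrow> 'a \<Rightarrow> 'a \<Rightarrow> 'b" where
  "D1 F z h = frechet_derivative F (at z) h"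

definition D2 :: "('a::real_normed_vector \<Rightarrow> 'b::real_normed_vector) \<Rightarrow> 'a \<Rightarrow> 'a \<Rightarrow> 'a \<Rightarrow> 'b" where
  "D2 F z h k = D1 (\<lambda>y. D1 F y k) z h"

text \<open>Differentiability of \<open>F\<close> and of all its directional derivatives, without continuity of the
  second derivatives.  This is all that the argument uses of smoothness.\<close>

definition twice_diff :: "('a::real_normed_vector \<Rightarrow> 'b::real_normed_vector) \<Rightarrow> bool" where
  "twice_diff F \<longleftrightarrow> (\<forall>z. F differentiable (at z)) \<and> (\<forall>k z. (\<lambda>y. D1 F y k) differentiable (at z))"

lemma smooth_imp_twice_diff: "smooth F \<Longrightarrow> twice_diff F"
  unfolding smooth_def twice_diff_def D1_def
  by (drule spec[of _ "Suc (Suc 0)"]) simp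

lemma twice_diff_D1: "twice_diff F \<Longrightarrow> (F has_derivative D1 F z) (at z)"
  unfolding twice_diff_def D1_def[abs_def] using frechet_derivative_works by blast

lemma twice_diff_D2: "twice_diff F \<Longrightarrow> ((\<lambda>y. D1 F y k) has_derivative (\<lambda>h. D2 F z h k)) (at z)"
  unfolding twice_diff_def D2_def D1_def[of _ z] using frechet_derivative_works by blast

lemma D1_eqI: "(F has_derivative F') (at z) \<Longrightarrow> D1 F z h = F' h"
  unfolding D1_def using frechet_derivative_at by metis

lemma D1_linear: "twice_diff F \<Longrightarrow> linear (D1 F z)"
  using twice_diff_D1 has_derivative_linear by blast

lemma D2_linear: "twice_diff F \<Longrightarrow> linear (\<lambda>h. D2 F z h k)"
  using twice_diff_D2 has_derivative_linear by blast

lemma D2_linear_right: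
  assumes F: "twice_diff F"
  shows "linear (D2 F z h)"
proof (rule linearI)
  fix k l :: 'a and c :: real
  have "((\<lambda>y. D1 F y k + D1 F y l) has_derivative (\<lambda>h. D2 F z h k + D2 F z h l)) (at z)"
    by (intro derivative_intros twice_diff_D2 F)
  then show "D2 F z h (k + l) = D2 F z h k + D2 F z h l"
    unfolding D2_def[of F z h "k + l"] linear_add[OF D1_linear[OF F]] by (rule D1_eqI)
  have "((\<lambda>y. c *\<^sub>R D1 F y k) has_derivative (\<lambda>h. c *\<^sub>R D2 F z h k)) (at z)"
    by (intro derivative_intros twice_diff_D2 F)
  then show "D2 F z h (c *\<^sub>R k) = c *\<^sub>R D2 F z h k"
    unfolding D2_def[of F z h "c *\<^sub>R k"] linear_cmul[OF D1_linear[OF F]] by (rule D1_eqI)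
qed

text \<open>The derivative of \<open>D1 F\<close> jointly in the point and in the direction.  Total derivatives are of
  this form: their direction \<open>(e\<^sub>j, D\<^sub>j v)\<close> is itself a coordinate of the jet.\<close>

lemma has_derivative_D1_moving_direction:
  fixes F :: "'a::euclidean_space \<Rightarrow> 'b::real_normed_vector"
  assumes F: "twice_diff F"
    and p: "(p has_derivative p') (at y)" and q: "(q has_derivative q') (at y)"
  shows "((\<lambda>y. D1 F (p y) (q y)) has_derivative (\<lambda>h. D2 F (p y) (p' h) (q y) + D1 F (p y) (q' h))) (at y)"
proof -
  \<comment> \<open>Expanding the direction in a basis leaves directional derivatives in fixed directions.\<close>
  have ex: "L a = (\<Sum>b\<in>Basis. (a \<bullet> b) *\<^sub>R L b)" if "linear L" for L :: "'a \<Rightarrow> 'b" and a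
  proof -
    have "L a = L (\<Sum>b\<in>Basis. (a \<bullet> b) *\<^sub>R b)" by (simp add: euclidean_representation)
    then show ?thesis by (simp add: linear_sum[OF that] linear_cmul[OF that])
  qed
  have comp: "((\<lambda>y. D1 F (p y) b) has_derivative (\<lambda>h. D2 F (p y) (p' h) b)) (at y)" for b
    using diff_chain_at[OF p twice_diff_D2[OF F]] by (simp add: o_def)
  have "((\<lambda>y. \<Sum>b\<in>Basis. (q y \<bullet> b) *\<^sub>R D1 F (p y) b) has_derivative
     (\<lambda>h. \<Sum>b\<in>Basis. (q y \<bullet> b) *\<^sub>R D2 F (p y) (p' h) b + (q' h \<bullet> b) *\<^sub>R D1 F (p y) b)) (at y)"
    by (intro derivative_intros comp q)
  then show ?thesis
    unfolding ex[OF D1_linear[OF F], symmetric] sum.distrib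
      ex[OF D2_linear_right[OF F], symmetric] .
qed

lemma D1_fst: "twice_diff F \<Longrightarrow> D1 (\<lambda>z. fst (F z)) z h = fst (D1 F z h)"
  by (rule D1_eqI) (intro derivative_intros twice_diff_D1)

lemma D1_snd: "twice_diff F \<Longrightarrow> D1 (\<lambda>z. snd (F z)) z h = snd (D1 F z h)"
  by (rule D1_eqI) (intro derivative_intros twice_diff_D1)

lemma twice_diff_fstI: "twice_diff F \<Longrightarrow> twice_diff (\<lambda>z. fst (F z))"
  unfolding twice_diff_def[of "\<lambda>z. fst (F z)"] D1_fst
  by (auto simp: differentiable_def intro!: has_derivative_fst exI twice_diff_D1 twice_diff_D2)

lemma twice_diff_sndI: "twice_diff F \<Longrightarrow> twice_diff (\<lambda>z. snd (F z))"
  unfolding twice_diff_def[of "\<lambda>z. snd (F z)"] D1_snd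
  by (auto simp: differentiable_def intro!: has_derivative_snd exI twice_diff_D1 twice_diff_D2)

lemma D2_fst: "twice_diff F \<Longrightarrow> D2 (\<lambda>z. fst (F z)) z h k = fst (D2 F z h k)"
  unfolding D2_def[of "\<lambda>z. fst (F z)"] D1_fst
  by (rule D1_eqI) (intro derivative_intros twice_diff_D2)

section \<open>The symmetry condition in coordinates\<close>

lemma has_derivative_vec_lambda:
  assumes "\<And>i. ((\<lambda>y. f y i) has_derivative (\<lambda>h. f' h i)) (at y)"
  shows "((\<lambda>y. (\<chi> i. f y i) :: real^'n::finite) has_derivative (\<lambda>h. \<chi> i. f' h i)) (at y)"
  apply (subst has_derivative_componentwise_within)
  using assms by (auto simp: Basis_vec_def inner_axis)

lemma total_deriv0_D1: "total_deriv0 j F (x, v, v1) = D1 F (x, v) (axis j 1, v1 $ j)"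
  by (simp add: total_deriv0_def D1_def)

lemma \<eta>1_D1:
  "\<eta>1 X j (x, v, v1) = D1 (\<eta> X) (x, v) (axis j 1, v1 $ j)
     - (\<Sum>k\<in>UNIV. D1 (\<xi> X) (x, v) (axis j 1, v1 $ j) $ k *\<^sub>R v1 $ k)"
  by (simp add: \<eta>1_def total_deriv0_D1)

lemma has_derivative_\<eta>1:
  fixes X :: "'n::finite vfield"
  assumes "twice_diff (\<xi> X)" "twice_diff (\<eta> X)"
  shows "(\<eta>1 X j has_derivative (\<lambda>(a, b, c).
     D2 (\<eta> X) (x, v) (a, b) (axis j 1, v1 $ j) + D1 (\<eta> X) (x, v) (0, c $ j)
     - (\<Sum>k\<in>UNIV. D1 (\<xi> X) (x, v) (axis j 1, v1 $ j) $ k *\<^sub>R c $ k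
       + (D2 (\<xi> X) (x, v) (a, b) (axis j 1, v1 $ j) + D1 (\<xi> X) (x, v) (0, c $ j)) $ k *\<^sub>R v1 $ k)))
     (at (x, v, v1))"
proof -
  let ?p = "\<lambda>z :: 'n jet1. (fst z, fst (snd z))"
  let ?q = "\<lambda>z :: 'n jet1. (axis j 1 :: real^'n, snd (snd z) $ j)"
  let ?q' = "\<lambda>z :: 'n jet1. (0 :: real^'n, snd (snd z) $ j)"
  note nth = bounded_linear.has_derivative[OF bounded_linear_vec_nth]
  have p: "(?p has_derivative ?p) (at z)" for z
    by (intro derivative_eq_intros) auto
  have q: "(?q has_derivative ?q') (at z)" for z
    by (intro derivative_intros nth)
  have eq: "\<eta>1 X j = (\<lambda>z. D1 (\<eta> X) (?p z) (?q z)
     - (\<Sum>k\<in>UNIV. D1 (\<xi> X) (?p z) (?q z) $ k *\<^sub>R snd (snd z) $ k))"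
    by (auto simp: fun_eq_iff \<eta>1_D1)
  show ?thesis
    unfolding eq
    apply (rule has_derivative_eq_rhs)
     apply (rule has_derivative_diff has_derivative_sum has_derivative_scaleR has_derivative_fst has_derivative_snd has_derivative_ident has_derivative_D1_moving_direction[OF _ p q] assms nth)+
    by (auto simp: fun_eq_iff)
qed

text \<open>Since the equations contain second derivatives only through the Laplacian, the diagonal
  coefficients of the second extension suffice.\<close>

lemma \<eta>2_diag:
  fixes X :: "'n::finite vfield" and v1 :: "('n vp, 'n) vec"
  assumes X: "twice_diff (\<xi> X)" "twice_diff (\<eta> X)" and jet: "\<And>i j. v2 $ i $ j = v2 $ j $ i"
  shows "\<eta>2 X i i (x, v, v1, v2) =
     D2 (\<eta> X) (x, v) (axis i 1, v1 $ i) (axis i 1, v1 $ i) + D1 (\<eta> X) (x, v) (0, v2 $ i $ i)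
     - (\<Sum>k\<in>UNIV. (D2 (\<xi> X) (x, v) (axis i 1, v1 $ i) (axis i 1, v1 $ i)
          + D1 (\<xi> X) (x, v) (0, v2 $ i $ i)) $ k *\<^sub>R v1 $ k)
     - 2 *\<^sub>R (\<Sum>k\<in>UNIV. D1 (\<xi> X) (x, v) (axis i 1, v1 $ i) $ k *\<^sub>R v2 $ k $ i)"
proof -
  have swap: "(\<Sum>k\<in>UNIV. a k *\<^sub>R v2 $ i $ k) = (\<Sum>k\<in>UNIV. a k *\<^sub>R v2 $ k $ i)" for a
    by (rule sum.cong[OF refl]) (subst jet, rule refl)
  have regroup: "a - (S + T) - S = a - T - 2 *\<^sub>R S" for a S T :: "'n vp"
    by (simp add: scaleR_2)
  note der = frechet_derivative_at[OF has_derivative_\<eta>1[OF X], symmetric]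
  have "\<eta>2 X i i (x, v, v1, v2) =
     D2 (\<eta> X) (x, v) (axis i 1, v1 $ i) (axis i 1, v1 $ i) + D1 (\<eta> X) (x, v) (0, v2 $ i $ i)
     - ((\<Sum>k\<in>UNIV. D1 (\<xi> X) (x, v) (axis i 1, v1 $ i) $ k *\<^sub>R v2 $ k $ i)
       + (\<Sum>k\<in>UNIV. (D2 (\<xi> X) (x, v) (axis i 1, v1 $ i) (axis i 1, v1 $ i)
          + D1 (\<xi> X) (x, v) (0, v2 $ i $ i)) $ k *\<^sub>R v1 $ k))
     - (\<Sum>k\<in>UNIV. D1 (\<xi> X) (x, v) (axis i 1, v1 $ i) $ k *\<^sub>R v2 $ k $ i)"
    by (simp only: \<eta>2_def total_deriv1_def prod.case total_deriv0_D1 der sum.distrib swap)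
  then show ?thesis
    unfolding regroup .
qed

lemma has_derivative_NS:
  "(NS has_derivative (\<lambda>(a, (b, q), c, d).
     ((\<Sum>i\<in>UNIV. fst (d $ i $ i)) - (\<chi> i. snd (c $ i))
        - (\<Sum>i\<in>UNIV. u $ i *\<^sub>R fst (c $ i) + b $ i *\<^sub>R fst (v1 $ i)),
      (\<Sum>i\<in>UNIV. fst (c $ i) $ i)))) (at (x, (u, p), v1, v2 :: (('n vp, 'n) vec, 'n::finite) vec))"
proof -
  note nth = bounded_linear.has_derivative[OF bounded_linear_vec_nth]
  have eq: "NS = (\<lambda>z :: 'n jet2.
     ((\<Sum>i\<in>UNIV. fst (snd (snd (snd z)) $ i $ i)) - (\<chi> i. snd (fst (snd (snd z)) $ i))
        - (\<Sum>i\<in>UNIV. fst (fst (snd z)) $ i *\<^sub>R fst (fst (snd (snd z)) $ i)),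
      (\<Sum>i\<in>UNIV. fst (fst (snd (snd z)) $ i) $ i)))"
    by (rule ext) (simp add: NS_def split_beta)
  show ?thesis
    unfolding eq
    apply (rule has_derivative_eq_rhs)
     apply (rule derivative_intros has_derivative_vec_lambda nth)+
    apply (simp add: fun_eq_iff)
    done
qed

text \<open>The two components of \<open>X\<^sub>2 NS\<close> at the jet \<open>(x, (u, p), v1, v2)\<close>, written in terms of the
  derivatives of \<open>\<xi>\<close> and \<open>\<eta>\<close>: \<open>ext_momentum\<close> belongs to the momentum equation and
  \<open>ext_divergence\<close> to the divergence.  Here \<open>h i\<close> is the direction \<open>(e\<^sub>i, D\<^sub>i v)\<close> of the \<open>i\<close>-th total derivative.\<close>

definition ext_momentum :: "'n::finite vfield \<Rightarrow> real^'n \<Rightarrow> real^'n \<Rightarrow> real \<Rightarrow> ('n vp, 'n) vec \<Rightarrow> (('n vp, 'n) vec, 'n) vec \<Rightarrow> real^'n" where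
  "ext_momentum X x u p v1 v2 =
    (let z = (x, u, p); h = (\<lambda>i. (axis i 1, v1 $ i)) in
     (\<Sum>i\<in>UNIV. fst (D2 (\<eta> X) z (h i) (h i) + D1 (\<eta> X) z (0, v2 $ i $ i))
        - (\<Sum>k\<in>UNIV. (D2 (\<xi> X) z (h i) (h i) + D1 (\<xi> X) z (0, v2 $ i $ i)) $ k *\<^sub>R fst (v1 $ k))
        - 2 *\<^sub>R (\<Sum>k\<in>UNIV. D1 (\<xi> X) z (h i) $ k *\<^sub>R fst (v2 $ k $ i)))
     - (\<chi> j. snd (D1 (\<eta> X) z (h j)) - (\<Sum>k\<in>UNIV. D1 (\<xi> X) z (h j) $ k * snd (v1 $ k)))
     - (\<Sum>i\<in>UNIV. u $ i *\<^sub>R (fst (D1 (\<eta> X) z (h i)) - (\<Sum>k\<in>UNIV. D1 (\<xi> X) z (h i) $ k *\<^sub>R fst (v1 $ k)))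
        + fst (\<eta> X z) $ i *\<^sub>R fst (v1 $ i)))"

definition ext_divergence :: "'n::finite vfield \<Rightarrow> real^'n \<Rightarrow> real^'n \<Rightarrow> real \<Rightarrow> ('n vp, 'n) vec \<Rightarrow> real" where
  "ext_divergence X x u p v1 =
    (let z = (x, u, p); h = (\<lambda>i. (axis i 1, v1 $ i)) in
     (\<Sum>i\<in>UNIV. fst (D1 (\<eta> X) z (h i)) $ i - (\<Sum>k\<in>UNIV. D1 (\<xi> X) z (h i) $ k * fst (v1 $ k) $ i)))"

lemma apply_extension2_NS:
  fixes X :: "'n::finite vfield"
  assumes X: "twice_diff (\<xi> X)" "twice_diff (\<eta> X)" and jet: "\<And>i j. v2 $ i $ j = v2 $ j $ i"
  shows "apply_extension2 X NS (x, (u, p), v1, v2) = (ext_momentum X x u p v1 v2, ext_divergence X x u p v1)"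
proof -
  have e: "\<eta> X (x, u, p) = (fst (\<eta> X (x, u, p)), snd (\<eta> X (x, u, p)))" by simp
  note d2 = \<eta>2_diag[OF X jet]
  show ?thesis
    unfolding apply_extension2_def extension2_def prod.case
    apply (subst frechet_derivative_at[OF has_derivative_NS, symmetric])
    apply (subst e)
    apply (simp only: prod.case vec_lambda_beta d2 \<eta>1_D1 ext_momentum_def ext_divergence_def Let_def)
    apply (simp only: fst_diff snd_diff fst_sum snd_sum fst_scaleR snd_scaleR sum_component vector_minus_component vector_scaleR_component real_scaleR_def)
    done
qed

lemma NS_symmetry_iff:
  fixes X :: "'n::finite vfield"
  assumes X: "twice_diff (\<xi> X)" "twice_diff (\<eta> X)"
  shows "NS_symmetry X \<longleftrightarrow> (\<forall>x u p v1 v2. (\<forall>i j. v2 $ i $ j = v2 $ j $ i) \<longrightarrow>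
     (\<Sum>i\<in>UNIV. fst (v2 $ i $ i)) = (\<chi> i. snd (v1 $ i)) + (\<Sum>i\<in>UNIV. u $ i *\<^sub>R fst (v1 $ i)) \<longrightarrow>
     (\<Sum>i\<in>UNIV. fst (v1 $ i) $ i) = 0 \<longrightarrow> ext_momentum X x u p v1 v2 = 0 \<and> ext_divergence X x u p v1 = 0)"
proof -
  have NS0: "NS (x, (u, p), v1, v2) = 0 \<longleftrightarrow>
     (\<Sum>i\<in>UNIV. fst (v2 $ i $ i)) = (\<chi> i. snd (v1 $ i)) + (\<Sum>i\<in>UNIV. u $ i *\<^sub>R fst (v1 $ i)) \<and>
     (\<Sum>i\<in>UNIV. fst (v1 $ i) $ i) = 0" for x u p v1 and v2 :: "(('n vp, 'n) vec, 'n) vec"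
    by (simp add: NS_def zero_prod_def diff_diff_eq)
  have ae: "apply_extension2 X NS (x, (u, p), v1, v2) = 0 \<longleftrightarrow> ext_momentum X x u p v1 v2 = 0 \<and> ext_divergence X x u p v1 = 0"
    if "\<forall>i j. v2 $ i $ j = v2 $ j $ i" for x u p v1 and v2 :: "(('n vp, 'n) vec, 'n) vec"
    using apply_extension2_NS[OF X] that by (simp add: zero_prod_def)
  show ?thesis
    unfolding NS_symmetry_def split_paired_All NS0 is_jet_def prod.case
    using ae by meson
qed

section \<open>Maps that are constant in some directions\<close>

lemma has_derivative_translate:
  assumes "(F has_derivative F') (at (z + c))"
  shows "((\<lambda>y. F (y + c)) has_derivative F') (at z)"
proof -
  have "((\<lambda>y. y + c) has_derivative (\<lambda>h. h)) (at z)"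
    by (rule derivative_eq_intros | simp)+
  from diff_chain_at[OF this assms] show ?thesis by (simp add: o_def)
qed

lemma D1_invariant:
  assumes F: "\<And>z. F differentiable (at z)" and inv: "\<And>z. F (z + c) = F z + d"
  shows "D1 F (z + c) h = D1 F z h"
proof -
  have F1: "(F has_derivative D1 F y) (at y)" for y
    unfolding D1_def[abs_def] using F frechet_derivative_works by blast
  have "((\<lambda>y. F (y + c)) has_derivative D1 F (z + c)) (at z)"
    by (rule has_derivative_translate) (rule F1)
  then have "((\<lambda>y. F y + d) has_derivative D1 F (z + c)) (at z)" unfolding inv .
  moreover have "((\<lambda>y. F y + d) has_derivative D1 F z) (at z)"
    using has_derivative_add[OF F1[of z] has_derivative_const[of d]] by simp
  ultimately show ?thesis by (metis has_derivative_unique)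
qed

lemma has_derivative_along_line:
  assumes "(F has_derivative F') (at (z + t *\<^sub>R c))"
  shows "((\<lambda>t. F (z + t *\<^sub>R c)) has_derivative (\<lambda>s. F' (s *\<^sub>R c))) (at t)"
proof -
  have "((\<lambda>t::real. z + t *\<^sub>R c) has_derivative (\<lambda>s. s *\<^sub>R c)) (at t)"
    by (rule derivative_eq_intros | simp)+
  from diff_chain_at[OF this assms] show ?thesis by (simp add: o_def)
qed

lemma D1_along_invariant:
  assumes F: "F differentiable (at z)" and inv: "\<And>t. F (z + t *\<^sub>R c) = F z"
  shows "D1 F z c = 0"
proof -
  have F1: "(F has_derivative D1 F z) (at (z + 0 *\<^sub>R c))"
    unfolding D1_def[abs_def] using F frechet_derivative_works by auto
  from has_derivative_along_line[OF F1]
  have "((\<lambda>t. F z) has_derivative (\<lambda>s. D1 F z (s *\<^sub>R c))) (at (0::real))" unfolding inv .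
  then have "(\<lambda>s. D1 F z (s *\<^sub>R c)) = (\<lambda>s. 0)"
    using has_derivative_const has_derivative_unique by blast
  from fun_cong[OF this, of 1] show ?thesis by simp
qed

lemma const_along_line:
  assumes F: "\<And>z. F differentiable (at z)" and zero: "\<And>z. D1 F z c = 0"
  shows "F (z + c) = F z"
proof -
  have F1: "(F has_derivative D1 F y) (at y)" for y
    unfolding D1_def[abs_def] using F frechet_derivative_works by blast
  have "((\<lambda>t. F (z + t *\<^sub>R c)) has_derivative (\<lambda>s. 0)) (at t)" for t
  proof -
    have "D1 F y (s *\<^sub>R c) = 0" for y s
      using linear_cmul[OF has_derivative_linear[OF F1[of y]], of s c] zero[of y] by simp
    then show ?thesis
      using has_derivative_along_line[OF F1[of "z + t *\<^sub>R c"]] by simp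
  qed
  then have "\<exists>k. \<forall>t\<in>UNIV. F (z + t *\<^sub>R c) = k"
    by (intro has_derivative_zero_constant) (auto)
  then obtain k where "F (z + t *\<^sub>R c) = k" for t by blast
  from this[of 0] this[of 1] show ?thesis by simp
qed

text \<open>The next lemma serves maps that depend on \<open>x\<close> only, among them derivatives of \<open>\<xi>\<close> and
  \<open>\<eta>\<close> in certain directions.\<close>

lemma D1_fst_only:
  assumes F: "\<And>z. F differentiable (at z)" and inv: "\<And>x v. F (x, v) = F (x, 0)"
  shows "D1 F (x, v) (a, b) = D1 F (x, 0) (a, 0)"
proof -
  have F1: "(F has_derivative D1 F y) (at y)" for y
    unfolding D1_def[abs_def] using F frechet_derivative_works by blast
  have "((\<lambda>z. (fst z, 0)) has_derivative (\<lambda>h. (fst h, 0))) (at (x, v))"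
    by (intro derivative_intros)
  from diff_chain_at[OF this, of F] F1[of "(x, 0)"]
  have "((\<lambda>z. F (fst z, 0)) has_derivative (\<lambda>h. D1 F (x, 0) (fst h, 0))) (at (x, v))"
    by (simp add: o_def)
  moreover have "(\<lambda>z. F (fst z, 0)) = F"
    by (simp add: fun_eq_iff inv[symmetric])
  ultimately have "(F has_derivative (\<lambda>h. D1 F (x, 0) (fst h, 0))) (at (x, v))" by simp
  from D1_eqI[OF this, of "(a, b)"] show ?thesis by simp
qed

lemma twice_diff_D1_differentiable: "twice_diff F \<Longrightarrow> (\<lambda>y. D1 F y k) differentiable (at z)"
  by (simp add: twice_diff_def)

lemma twice_diff_differentiable: "twice_diff F \<Longrightarrow> F differentiable (at z)"
  by (simp add: twice_diff_def)

section \<open>Two rigidity lemmas\<close>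

text \<open>If the derivative of a map of \<open>\<real>\<^sup>n\<close>, \<open>n \<ge> 2\<close>, is everywhere a multiple of the identity, the
  multiple is constant: the \<open>i\<close>-th component depends on the \<open>i\<close>-th coordinate only.\<close>

lemma scalar_derivative_const:
  fixes f :: "real^'n::finite \<Rightarrow> real^'n"
  assumes f: "\<And>u. (f has_derivative (\<lambda>w. l u *\<^sub>R w)) (at u)" and ij: "(i::'n) \<noteq> j"
  shows "l u = l 0" and "f u = l 0 *\<^sub>R u + f 0"
proof -
  \<comment> \<open>\<open>f u $ k\<close> depends on \<open>u $ k\<close> only, and so does its derivative \<open>l u\<close> in the direction \<open>e\<^sub>k\<close>.\<close>
  have same: "l u = l u'" if "u $ k = u' $ k" for u u' k
  proof -
    have comp: "((\<lambda>u. f u $ k) has_derivative (\<lambda>w. l u * w $ k)) (at u)" for u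
      using bounded_linear.has_derivative[OF bounded_linear_vec_nth f, of k] by simp
    have diff: "(\<lambda>u. f u $ k) differentiable (at u)" for u
      using comp differentiable_def by blast
    have D: "D1 (\<lambda>u. f u $ k) u w = l u * w $ k" for u w
      using comp by (rule D1_eqI)
    have shift: "f (u + (u' - u)) $ k = f u $ k + 0" if "u $ k = u' $ k" for u u'
      using const_along_line[of "\<lambda>u. f u $ k" "u' - u" u] that by (simp add: D diff)
    have "D1 (\<lambda>u. f u $ k) (u + (u' - u)) (axis k 1) = D1 (\<lambda>u. f u $ k) u (axis k 1)"
    proof (rule D1_invariant[OF diff])
      fix z
      show "f (z + (u' - u)) $ k = f z $ k + 0"
        using shift[of z "z + (u' - u)"] that by simp
    qed
    then show ?thesis by (simp add: D)
  qed
  show l: "l u = l 0" for u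
  proof -
    \<comment> \<open>\<open>u\<close> and \<open>0\<close> are joined through a point that shares the \<open>i\<close>-th coordinate with the former
      and the \<open>j\<close>-th with the latter.\<close>
    have "l u = l (axis i (u $ i))" by (rule same[of _ i]) simp
    also have "\<dots> = l 0" using ij by (intro same[of _ j]) (simp add: axis_def)
    finally show ?thesis .
  qed
  have "(f has_derivative (\<lambda>w. l 0 *\<^sub>R w)) (at u)" for u
    using f[of u] unfolding l[of u] .
  from has_derivative_diff[OF this has_derivative_scaleR_right[OF has_derivative_ident, of "l 0"]]
  have "((\<lambda>u. f u - l 0 *\<^sub>R u) has_derivative (\<lambda>w. 0)) (at u within UNIV)" for u
    by simp
  then have "\<exists>c. \<forall>u\<in>UNIV. f u - l 0 *\<^sub>R u = c"
    by (intro has_derivative_zero_constant) auto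
  then obtain c where c: "f u - l 0 *\<^sub>R u = c" for u by blast
  from c[of u] c[of 0] show "f u = l 0 *\<^sub>R u + f 0" by (simp add: algebra_simps)
qed

lemma skewI:
  fixes A :: "real^'n::finite^'n"
  assumes sk: "\<And>i j. A $ j $ i = - A $ i $ j"
  shows "transpose A = - A"
proof -
  have "transpose A $ i $ j = (- A) $ i $ j" for i j
    using sk[where i = i and j = j] by (simp add: transpose_def)
  then show ?thesis by (simp only: vec_eq_iff) blast
qed

text \<open>A vector field with skew derivative (a Killing field) satisfies
  \<open>(k x - k y) \<bullet> (x - y) = 0\<close>.  Polarised, this makes \<open>k x \<bullet> y\<close> linear in \<open>x\<close> after
  subtraction of \<open>k 0\<close>, so that \<open>k\<close> is affine.\<close>

lemma killing_affine:
  fixes k :: "real^'n::finite \<Rightarrow> real^'n"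
  assumes k: "\<And>x. (k has_derivative k' x) (at x)" and skew: "\<And>x a. k' x a \<bullet> a = 0"
  obtains A where "transpose A = - A" and "\<And>x. k x = A *v x + k 0"
proof -
  have *: "(k x - k y) \<bullet> (x - y) = 0" for x y
  proof -
    have d: "((\<lambda>z. k z \<bullet> (x - y)) has_derivative (\<lambda>a. k' z a \<bullet> (x - y))) (at z)" for z
      using has_derivative_inner_left[OF k] .
    have "k (y + (x - y)) \<bullet> (x - y) = k y \<bullet> (x - y)"
      using d by (intro const_along_line[of "\<lambda>z. k z \<bullet> (x - y)"])
        (auto simp: differentiable_def D1_eqI[OF d] skew)
    then show ?thesis by (simp add: inner_diff_left)
  qed
  define m where "m x = k x - k 0" for x
  have m0: "m x \<bullet> x = 0" for x using *[of x 0] by (simp add: m_def)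
  have anti: "m x \<bullet> y = - (m y \<bullet> x)" for x y
  proof -
    have "(m x - m y) \<bullet> (x - y) = 0" using *[of x y] by (simp add: m_def)
    then show ?thesis using m0[of x] m0[of y] by (simp add: inner_diff_left inner_diff_right)
  qed
  have lin: "linear m"
  proof (rule linearI)
    fix x y and c :: real
    have "m (x + y) \<bullet> w = (m x + m y) \<bullet> w" for w
      by (simp add: anti[of _ w] inner_add_left inner_add_right)
    then show "m (x + y) = m x + m y" by (metis vector_eq_rdot)
    have "m (c *\<^sub>R x) \<bullet> w = (c *\<^sub>R m x) \<bullet> w" for w
      by (simp add: anti[of _ w])
    then show "m (c *\<^sub>R x) = c *\<^sub>R m x" by (metis vector_eq_rdot)
  qed
  then have mv: "matrix m *v x = m x" for x by (simp add: matrix_works)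
  show ?thesis
  proof
    show "transpose (matrix m) = - matrix m"
    proof (rule skewI)
      fix i j
      show "matrix m $ j $ i = - matrix m $ i $ j"
        using anti[of "axis i 1" "axis j 1"] by (simp add: matrix_def inner_axis)
    qed
    show "k x = matrix m *v x + k 0" for x by (simp add: mv m_def)
  qed
qed

section \<open>The determining equations\<close>

lemma axis_nth_if: "axis i m $ r = (if r = i then m else 0)"
  by (simp add: axis_def)

lemma vec_expand: "y = (\<Sum>i\<in>UNIV. y $ i *\<^sub>R axis i 1)" for y :: "real^'n::finite"
  using basis_expansion[of y] by (simp add: scalar_mult_eq_scaleR)

text \<open>The divergence of \<open>u\<close>, the convective term \<open>u \<cdot> \<nabla> u\<close> and the pressure gradient as functions of
  the first-order jet coordinates.\<close>

definition div_u :: "('n vp, 'n::finite) vec \<Rightarrow> real" where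
  "div_u v1 = (\<Sum>i\<in>UNIV. fst (v1 $ i) $ i)"

lemma div_u_axis: "div_u (axis i m) = fst m $ i"
proof -
  have "fst (axis i m $ r) $ r = (if r = i then fst m $ i else 0)" for r
    by (simp add: axis_nth_if)
  then show ?thesis by (simp add: div_u_def)
qed

lemma div_u_add: "div_u (v + w) = div_u v + div_u w"
  by (simp add: div_u_def sum.distrib)

lemma div_u_zero [simp]: "div_u 0 = 0"
  by (simp add: div_u_def)

lemma div_u_minus: "div_u (- v) = - div_u v"
  by (simp add: div_u_def sum_negf)

definition convection :: "real^'n \<Rightarrow> ('n vp, 'n::finite) vec \<Rightarrow> real^'n" where
  "convection u v1 = (\<Sum>i\<in>UNIV. u $ i *\<^sub>R fst (v1 $ i))"

definition grad_p :: "('n vp, 'n::finite) vec \<Rightarrow> real^'n" where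
  "grad_p v1 = (\<chi> i. snd (v1 $ i))"

text \<open>A symmetry \<open>X\<close> with twice differentiable coefficients, in dimension at least two, which is
  witnessed by two different indices.\<close>

locale NS_sym =
  fixes X :: "'n::finite vfield" and a0 b0 :: 'n
  assumes td_\<xi>: "twice_diff (\<xi> X)" and td_\<eta>: "twice_diff (\<eta> X)"
    and symm: "NS_symmetry X" and a0b0: "a0 \<noteq> b0"
begin

text \<open>The components of \<open>X\<close>: \<open>k\<close> along \<open>x\<close>, \<open>f\<close> along \<open>u\<close> and \<open>g\<close> along \<open>p\<close>.\<close>

definition k where "k = \<xi> X"
definition f where "f = (\<lambda>z. fst (\<eta> X z))"
definition g where "g = (\<lambda>z. snd (\<eta> X z))"

lemma td: "twice_diff k" "twice_diff f" "twice_diff g"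
  unfolding k_def f_def g_def using td_\<xi> td_\<eta> twice_diff_fstI twice_diff_sndI by blast+

lemmas lin = td[THEN D1_linear]

lemma D_\<eta>: "fst (D1 (\<eta> X) z h) = D1 f z h" "snd (D1 (\<eta> X) z h) = D1 g z h"
  "fst (D2 (\<eta> X) z h h') = D2 f z h h'"
  unfolding f_def g_def using D1_fst D1_snd D2_fst td_\<eta> by metis+

text \<open>The momentum condition is affine in the second-order coordinates: \<open>second_part\<close> is its linear part
  and \<open>lower_part\<close> the remainder.\<close>

definition second_part where
  "second_part z v1 w = (\<Sum>i\<in>UNIV. D1 f z (0, w $ i $ i) - (\<Sum>l\<in>UNIV. D1 k z (0, w $ i $ i) $ l *\<^sub>R fst (v1 $ l)))
     - 2 *\<^sub>R (\<Sum>i\<in>UNIV. \<Sum>l\<in>UNIV. D1 k z (axis i 1, v1 $ i) $ l *\<^sub>R fst (w $ l $ i))"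

definition lower_part where
  "lower_part z v1 = (\<Sum>i\<in>UNIV. D2 f z (axis i 1, v1 $ i) (axis i 1, v1 $ i))
     - (\<Sum>i\<in>UNIV. \<Sum>l\<in>UNIV. D2 k z (axis i 1, v1 $ i) (axis i 1, v1 $ i) $ l *\<^sub>R fst (v1 $ l))
     - (\<chi> j. D1 g z (axis j 1, v1 $ j) - (\<Sum>l\<in>UNIV. D1 k z (axis j 1, v1 $ j) $ l * snd (v1 $ l)))
     - (\<Sum>i\<in>UNIV. fst (snd z) $ i *\<^sub>R (D1 f z (axis i 1, v1 $ i) - (\<Sum>l\<in>UNIV. D1 k z (axis i 1, v1 $ i) $ l *\<^sub>R fst (v1 $ l))))
     - (\<Sum>i\<in>UNIV. f z $ i *\<^sub>R fst (v1 $ i))"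

lemma ext_momentum_eq: "ext_momentum X x u p v1 v2 = second_part (x, u, p) v1 v2 + lower_part (x, u, p) v1"
  unfolding ext_momentum_def second_part_def lower_part_def Let_def fst_add D_\<eta> fst_conv snd_conv
    k_def[symmetric]
  by (simp add: f_def sum.distrib sum_subtractf scaleR_add_left scaleR_sum_right)

lemma ext_momentum_zero:
  assumes "\<And>i j. v2 $ i $ j = v2 $ j $ i" "(\<Sum>i\<in>UNIV. fst (v2 $ i $ i)) = grad_p v1 + convection u v1" "div_u v1 = 0"
  shows "second_part (x, u, p) v1 v2 + lower_part (x, u, p) v1 = 0"
  using symm[unfolded NS_symmetry_iff[OF td_\<xi> td_\<eta>]] assms
  unfolding ext_momentum_eq div_u_def grad_p_def convection_def by blast

lemma ext_divergence_zero:
  assumes "div_u v1 = 0"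
  shows "(\<Sum>i\<in>UNIV. D1 f z (axis i 1, v1 $ i) $ i
     - (\<Sum>l\<in>UNIV. D1 k z (axis i 1, v1 $ i) $ l * fst (v1 $ l) $ i)) = 0"
proof -
  obtain x u p where z: "z = (x, u, p)" by (metis prod.collapse)
  \<comment> \<open>A choice of second derivatives that completes \<open>v1\<close> to a jet on the equation.\<close>
  define v2 :: "(('n vp, 'n) vec, 'n) vec" where
    "v2 = axis a0 (axis a0 (grad_p v1 + convection u v1, 0))"
  have "fst (v2 $ i $ i) = (if i = a0 then grad_p v1 + convection u v1 else 0)" for i
    by (simp add: v2_def axis_nth_if)
  then have "(\<Sum>i\<in>UNIV. fst (v2 $ i $ i)) = grad_p v1 + convection u v1"
    by simp
  moreover have "v2 $ i $ j = v2 $ j $ i" for i j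
    by (simp add: v2_def axis_nth_if)
  ultimately have "ext_divergence X x u p v1 = 0"
    using symm[unfolded NS_symmetry_iff[OF td_\<xi> td_\<eta>]] assms
    unfolding div_u_def grad_p_def convection_def by blast
  then show ?thesis unfolding z ext_divergence_def Let_def D_\<eta> k_def .
qed

lemma second_part_add: "second_part z v1 (w + w') = second_part z v1 w + second_part z v1 w'"
proof -
  have *: "D1 F z (0, a + b) = D1 F z (0, a) + D1 F z (0, b)"
    if "linear (D1 F z)" for a b and F :: "'n point \<Rightarrow> real^'n"
    using linear_add[OF that, of "(0, a)" "(0, b)"] by simp
  show ?thesis
    by (simp add: second_part_def *[OF lin(1)] *[OF lin(2)] sum.distrib sum_subtractf
        scaleR_add_left scaleR_add_right)
qed

lemma second_part_axis:
  "second_part z v1 (axis i (axis j m)) =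
     (if i = j then D1 f z (0, m) - (\<Sum>l\<in>UNIV. D1 k z (0, m) $ l *\<^sub>R fst (v1 $ l)) else 0)
     - 2 *\<^sub>R (D1 k z (axis j 1, v1 $ j) $ i *\<^sub>R fst m)"
proof -
  define T where "T m = D1 f z (0, m) - (\<Sum>l\<in>UNIV. D1 k z (0, m) $ l *\<^sub>R fst (v1 $ l))" for m
  have T0: "T 0 = 0"
    using linear_0[OF lin(1)[of z]] linear_0[OF lin(2)[of z]] by (simp add: T_def zero_prod_def)
  have "T (axis i (axis j m) $ r $ r) = (if r = i then if i = j then T m else 0 else 0)" for r
    by (simp add: axis_nth_if T0)
  then have 1: "(\<Sum>r\<in>UNIV. T (axis i (axis j m) $ r $ r)) = (if i = j then T m else 0)"
    by simp
  have "(\<Sum>l\<in>UNIV. D1 k z (axis r 1, v1 $ r) $ l *\<^sub>R fst (axis i (axis j m) $ l $ r))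
      = (if r = j then D1 k z (axis j 1, v1 $ j) $ i *\<^sub>R fst m else 0)" for r
  proof -
    have "D1 k z (axis r 1, v1 $ r) $ l *\<^sub>R fst (axis i (axis j m) $ l $ r)
      = (if l = i then if r = j then D1 k z (axis j 1, v1 $ j) $ i *\<^sub>R fst m else 0 else 0)" for l
      by (simp add: axis_nth_if)
    then show ?thesis by simp
  qed
  then have 2: "(\<Sum>r\<in>UNIV. \<Sum>l\<in>UNIV. D1 k z (axis r 1, v1 $ r) $ l *\<^sub>R fst (axis i (axis j m) $ l $ r))
      = D1 k z (axis j 1, v1 $ j) $ i *\<^sub>R fst m"
    by simp
  show ?thesis
    unfolding second_part_def 2 using 1 unfolding T_def by simp
qed

text \<open>The second-order part of the condition vanishes separately: the equation leaves the trace-free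
  part of the second derivatives of \<open>u\<close> free.\<close>

lemma second_part_zero:
  assumes w: "\<And>i j. w $ i $ j = w $ j $ i" "(\<Sum>i\<in>UNIV. fst (w $ i $ i)) = 0" and v1: "div_u v1 = 0"
  shows "second_part z v1 w = 0"
proof -
  obtain x u p where z: "z = (x, u, p)" by (metis prod.collapse)
  define v2 :: "(('n vp, 'n) vec, 'n) vec" where
    "v2 = axis a0 (axis a0 (grad_p v1 + convection u v1, 0))"
  have "fst (v2 $ i $ i) = (if i = a0 then grad_p v1 + convection u v1 else 0)" for i
    by (simp add: v2_def axis_nth_if)
  then have sum2: "(\<Sum>i\<in>UNIV. fst (v2 $ i $ i)) = grad_p v1 + convection u v1"
    by simp
  have sy: "v2 $ i $ j = v2 $ j $ i" for i j
    by (simp add: v2_def axis_nth_if)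
  have "second_part z v1 v2 + lower_part z v1 = 0"
    unfolding z using ext_momentum_zero[OF sy sum2 v1] .
  moreover have "second_part z v1 (v2 + w) + lower_part z v1 = 0"
    unfolding z using sum2 w(2) v1
    by (intro ext_momentum_zero) (simp_all add: sum.distrib sy[symmetric] w(1)[symmetric])
  moreover have "second_part z v1 w = (second_part z v1 (v2 + w) + lower_part z v1) - (second_part z v1 v2 + lower_part z v1)"
    by (simp add: second_part_add)
  ultimately show ?thesis by simp
qed

text \<open>Testing with an off-diagonal Hessian, and with a trace-free diagonal one, shows that the total
  derivative of \<open>\<xi>\<close> is conformal for all trace-free \<open>v1\<close>.\<close>

lemma offdiag:
  assumes ij: "i \<noteq> j" and v1: "div_u v1 = 0"
  shows "D1 k z (axis i 1, v1 $ i) $ j + D1 k z (axis j 1, v1 $ j) $ i = 0"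
proof -
  define e :: "real^'n" where "e = axis i 1"
  have e: "e \<noteq> 0" by (simp add: e_def axis_eq_0_iff)
  have "second_part z v1 (axis i (axis j (e, 0)) + axis j (axis i (e, 0))) = 0"
  proof (rule second_part_zero[OF _ _ v1])
    have "fst ((axis i (axis j (e, 0 :: real)) + axis j (axis i (e, 0))) $ r $ r) = 0" for r
      using ij by (simp add: axis_nth_if)
    then show "(\<Sum>r\<in>UNIV. fst ((axis i (axis j (e, 0 :: real)) + axis j (axis i (e, 0))) $ r $ r)) = 0"
      by simp
  qed (auto simp: axis_nth_if)
  then have "(- 2 * (D1 k z (axis i 1, v1 $ i) $ j + D1 k z (axis j 1, v1 $ j) $ i)) *\<^sub>R e = 0"
    using ij by (simp add: second_part_add second_part_axis algebra_simps)
  then show ?thesis using e by simp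
qed

lemma ondiag:
  assumes v1: "div_u v1 = 0"
  shows "D1 k z (axis i 1, v1 $ i) $ i = D1 k z (axis j 1, v1 $ j) $ j"
proof (cases "i = j")
  case False
  define e :: "real^'n" where "e = axis i 1"
  have e: "e \<noteq> 0" by (simp add: e_def axis_eq_0_iff)
  have "second_part z v1 (axis i (axis i (e, 0)) + axis j (axis j (- e, 0))) = 0"
  proof (rule second_part_zero[OF _ _ v1])
    have "fst ((axis i (axis i (e, 0 :: real)) + axis j (axis j (- e, 0))) $ r $ r)
       = (if r = i then e else 0) - (if r = j then e else 0)" for r
      by (simp add: axis_nth_if)
    then show "(\<Sum>r\<in>UNIV. fst ((axis i (axis i (e, 0 :: real)) + axis j (axis j (- e, 0))) $ r $ r)) = 0"
      by (simp add: sum_subtractf)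
  qed (auto simp: axis_nth_if)
  moreover have "D1 f z (0, - e, 0) = - D1 f z (0, e, 0)" "D1 k z (0, - e, 0) = - D1 k z (0, e, 0)"
    using linear_neg[OF lin(2), of z "(0, e, 0)"] linear_neg[OF lin(1), of z "(0, e, 0)"] by simp_all
  ultimately have "(- 2 * (D1 k z (axis i 1, v1 $ i) $ i - D1 k z (axis j 1, v1 $ j) $ j)) *\<^sub>R e = 0"
    by (simp add: second_part_add second_part_axis sum_negf algebra_simps)
  then show ?thesis using e by simp
qed simp

lemma D1_split:
  assumes "linear (D1 F z)"
  shows "D1 F z (a, m) = D1 F z (a, 0) + D1 F z (0, m)"
  using linear_add[OF assms, of "(a, 0)" "(0, m)"] by simp

text \<open>The conformality holds for \<open>v1 = 0\<close> and for every trace-free \<open>v1\<close>; the difference shows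
  that \<open>\<xi>\<close> depends on \<open>x\<close> only.\<close>

lemma k_vertical: "D1 k z (0, m) = 0"
proof -
  have D: "D1 k z (0, 0) = 0" using linear_0[OF lin(1)[of z]] by (simp add: zero_prod_def)
  have sp: "D1 k z (axis i 1, v1 $ j) = D1 k z (axis i 1, 0) + D1 k z (0, v1 $ j)" for i j v1
    by (rule D1_split[OF lin(1)])
  have off: "D1 k z (0, v1 $ i) $ j + D1 k z (0, v1 $ j) $ i = 0" if "i \<noteq> j" "div_u v1 = 0" for i j v1
    using offdiag[OF that, of z] offdiag[OF that(1) div_u_zero, of z]
    by (simp add: sp[of i] sp[of j])
  have on: "D1 k z (0, v1 $ i) $ i = D1 k z (0, v1 $ j) $ j" if "div_u v1 = 0" for i j v1
    using ondiag[OF that, of z i j] ondiag[OF div_u_zero, of z i j]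
    by (simp add: sp[of i] sp[of j])
  have vanish: "D1 k z (0, (y, q)) = 0" if y: "y $ i = 0" for y q i
  proof -
    have t: "div_u (axis i (y, q)) = 0" using y by (simp add: div_u_axis)
    obtain i' where i': "i' \<noteq> i" using a0b0 by metis
    have "D1 k z (0, (y, q)) $ j = 0" for j
    proof (cases "j = i")
      case True
      then show ?thesis using on[OF t, of i i'] i' by (simp add: axis_nth_if D)
    next
      case False
      then show ?thesis using off[OF _ t, of i j] by (simp add: axis_nth_if D)
    qed
    then show ?thesis by (simp add: vec_eq_iff)
  qed
  obtain y q where m: "m = (y, q)" by fastforce
  have "(0, m) = (0, (axis a0 (y $ a0), 0)) + (0 :: real^'n, (y - axis a0 (y $ a0), q))"
    by (simp add: m)
  then have "D1 k z (0, m) = D1 k z (0, (axis a0 (y $ a0), 0)) + D1 k z (0, (y - axis a0 (y $ a0), q))"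
    using linear_add[OF lin(1)] by metis
  also have "\<dots> = 0"
    using vanish[of "axis a0 (y $ a0)" b0] vanish[of "y - axis a0 (y $ a0)" a0] a0b0
    by (simp add: axis_nth_if)
  finally show ?thesis .
qed

lemma k_fst: "k (x, v) = k (x, 0)"
  using const_along_line[of k "(0, v)" "(x, 0)"] k_vertical td(1)
  by (simp add: twice_diff_differentiable)

text \<open>\<open>Z x\<close> is the derivative of \<open>\<xi>\<close>, viewed as a map of \<open>x\<close> alone.\<close>

definition Z :: "real^'n \<Rightarrow> real^'n \<Rightarrow> real^'n" where "Z x a = D1 k (x, 0) (a, 0)"

lemma D1_k: "D1 k (x, v) (a, m) = Z x a"
  unfolding Z_def by (rule D1_fst_only[OF twice_diff_differentiable[OF td(1)] k_fst])

lemma Z_linear: "linear (Z x)"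
proof (rule linearI)
  show "Z x (a + b) = Z x a + Z x b" for a b
    using linear_add[OF lin(1), of "(x, 0)" "(a, 0)" "(b, 0)"] by (simp add: Z_def)
  show "Z x (c *\<^sub>R a) = c *\<^sub>R Z x a" for a c
    using linear_cmul[OF lin(1), of "(x, 0)" c "(a, 0)"] by (simp add: Z_def)
qed

text \<open>The Laplacian of \<open>\<xi>\<close> in \<open>x\<close>.\<close>

definition laplace_k :: "real^'n \<Rightarrow> real^'n" where
  "laplace_k x = (\<Sum>i\<in>UNIV. D2 k (x, 0) (axis i 1, 0) (axis i 1, 0))"

lemma D2_k: "D2 k (x, v) (a, m) (b, m') = D2 k (x, 0) (a, 0) (b, 0)"
proof -
  have eq: "(\<lambda>y. D1 k y (b, m')) = (\<lambda>y. D1 k y (b, 0))"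
    by (auto simp: fun_eq_iff D1_k)
  show ?thesis
    unfolding D2_def eq
    by (rule D1_fst_only[OF twice_diff_D1_differentiable[OF td(1)]]) (simp add: D1_k)
qed

text \<open>The conformal factor of \<open>\<xi>\<close>: the symmetric part of \<open>Z x\<close> is \<open>\<sigma> x\<close> times the identity.\<close>

definition \<sigma> :: "real^'n \<Rightarrow> real" where "\<sigma> x = Z x (axis a0 1) $ a0"

lemma Z_off: "i \<noteq> j \<Longrightarrow> Z x (axis i 1) $ j + Z x (axis j 1) $ i = 0"
  using offdiag[of i j 0 "(x, 0)"] by (simp add: D1_k)

lemma Z_diag: "Z x (axis i 1) $ i = \<sigma> x"
  using ondiag[of 0 "(x, 0)" i a0] by (simp add: D1_k \<sigma>_def)

lemma Z_sum: "Z x a = (\<Sum>i\<in>UNIV. a $ i *\<^sub>R Z x (axis i 1))"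
  using arg_cong[OF vec_expand[of a], of "Z x"]
  by (simp add: linear_sum[OF Z_linear] linear_cmul[OF Z_linear])

lemma Z_conformal: "Z x a \<bullet> b + Z x b \<bullet> a = 2 * \<sigma> x * (a \<bullet> b)"
proof -
  have e: "Z x a \<bullet> b = (\<Sum>i\<in>UNIV. \<Sum>j\<in>UNIV. a $ i * b $ j * Z x (axis i 1) $ j)" for a b
    unfolding Z_sum[of x a] inner_vec_def
    by (simp add: sum_distrib_right sum_distrib_left mult_ac)
      (subst sum.swap, simp add: mult_ac)
  have "Z x a \<bullet> b + Z x b \<bullet> a
     = (\<Sum>i\<in>UNIV. \<Sum>j\<in>UNIV. a $ i * b $ j * Z x (axis i 1) $ j + b $ j * a $ i * Z x (axis j 1) $ i)"
    unfolding e[of a b] e[of b a] sum.distrib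
    by (subst (2) sum.swap) simp
  also have "\<dots> = (\<Sum>i\<in>UNIV. \<Sum>j\<in>UNIV. if j = i then 2 * \<sigma> x * (a $ i * b $ i) else 0)"
  proof (intro sum.cong refl)
    fix i j
    have "a $ i * b $ j * Z x (axis i 1) $ j + b $ j * a $ i * Z x (axis j 1) $ i
       = a $ i * b $ j * (Z x (axis i 1) $ j + Z x (axis j 1) $ i)"
      by (simp add: algebra_simps)
    then show "a $ i * b $ j * Z x (axis i 1) $ j + b $ j * a $ i * Z x (axis j 1) $ i
       = (if j = i then 2 * \<sigma> x * (a $ i * b $ i) else 0)"
      using Z_off[of i j x] by (simp add: Z_diag)
  qed
  also have "\<dots> = 2 * \<sigma> x * (a \<bullet> b)"
    by (simp add: inner_vec_def sum_distrib_left)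
  finally show ?thesis .
qed

subsection \<open>The dependence on velocity and pressure\<close>

text \<open>The Laplacian of \<open>p\<close> does not occur in the equations; therefore \<open>f\<close> does not depend on \<open>p\<close>.\<close>

lemma f_pressure: "D1 f z (0, (0, q)) = 0"
proof -
  have "second_part z 0 (axis a0 (axis a0 (0, 1))) = 0"
  proof (rule second_part_zero)
    have "fst (axis a0 (axis a0 (0 :: real^'n, 1 :: real)) $ i $ i) = 0" for i
      by (simp add: axis_nth_if)
    then show "(\<Sum>i\<in>UNIV. fst (axis a0 (axis a0 (0 :: real^'n, 1 :: real)) $ i $ i)) = 0" by simp
  qed (simp_all add: axis_nth_if)
  then have "D1 f z (0, (0, 1)) = 0" by (simp add: second_part_axis)
  then show ?thesis using linear_cmul[OF lin(2), of z q "(0, (0, 1))"] by simp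
qed

text \<open>The divergence condition forces the \<open>u\<close>-derivative of the \<open>u\<close>-component of \<open>\<eta>\<close> to differ from
  \<open>Z x\<close> by a multiple of the identity only; \<open>\<mu>\<close> is this multiple, read off the entry
  \<open>(a0, a0)\<close>.\<close>

definition \<mu> :: "'n point \<Rightarrow> real" where
  "\<mu> z = D1 f z (0, (axis a0 1, 0)) $ a0 - \<sigma> (fst z)"

lemma D1_f_vertical: "D1 f (x, v) (0, (y, q)) = Z x y + \<mu> (x, v) *\<^sub>R y"
proof -
  \<comment> \<open>In terms of \<open>W\<close> the divergence condition says that \<open>\<Sum>\<^sub>r W (D\<^sub>r v)\<^sub>r = 0\<close> for trace-free \<open>v1\<close>.\<close>
  define W where "W m = D1 f (x, v) (0, m) - Z x (fst m)" for m
  have W_add: "W (m + m') = W m + W m'" for m m'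
    using linear_add[OF lin(2), of "(x, v)" "(0, m)" "(0, m')"] by (simp add: W_def linear_add[OF Z_linear])
  have W_scale: "W (t *\<^sub>R m) = t *\<^sub>R W m" for m t
    using linear_cmul[OF lin(2), of "(x, v)" t "(0, m)"]
    by (simp add: W_def linear_cmul[OF Z_linear] scaleR_diff_right)
  have W0: "W 0 = 0" using W_scale[of 0 0] by simp
  have zero: "(\<Sum>r\<in>UNIV. W (v1 $ r) $ r) = 0" if "div_u v1 = 0" for v1
  proof -
    have e: "(\<Sum>i\<in>UNIV. \<Sum>l\<in>UNIV. Z x (axis i 1) $ l * fst (v1 $ l) $ i) = (\<Sum>l\<in>UNIV. Z x (fst (v1 $ l)) $ l)" for v1
      by (subst sum.swap) (simp add: Z_sum[of x "fst _"] mult.commute)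
    have s: "D1 f (x, v) (axis r 1, v1 $ r) = D1 f (x, v) (axis r 1, 0) + D1 f (x, v) (0, v1 $ r)" for r v1
      by (rule D1_split[OF lin(2)])
    have "(\<Sum>r\<in>UNIV. D1 f (x, v) (axis r 1, 0) $ r) = 0"
      using ext_divergence_zero[OF div_u_zero, of "(x, v)"] by (simp add: D1_k)
    moreover have "(\<Sum>r\<in>UNIV. D1 f (x, v) (axis r 1, 0) $ r) + (\<Sum>r\<in>UNIV. D1 f (x, v) (0, v1 $ r) $ r)
       - (\<Sum>l\<in>UNIV. Z x (fst (v1 $ l)) $ l) = 0"
      using ext_divergence_zero[OF that, of "(x, v)"] unfolding s D1_k
      by (simp add: sum_subtractf sum.distrib e)
    ultimately show ?thesis by (simp add: W_def sum_subtractf)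
  qed
  have W_axis: "(\<Sum>r\<in>UNIV. W (axis i m $ r) $ r) = W m $ i" for i m
  proof -
    have "W (axis i m $ r) $ r = (if r = i then W m $ i else 0)" for r
      by (simp add: axis_nth_if W0)
    then show ?thesis by simp
  qed
  have off: "W (y, q) $ i = 0" if "y $ i = 0" for y q i
    using zero[of "axis i (y, q)"] that by (simp add: div_u_axis W_axis)
  have on: "W (axis i 1, 0) $ i = \<mu> (x, v)" for i
  proof (cases "i = a0")
    case True
    then show ?thesis by (simp add: W_def \<mu>_def \<sigma>_def)
  next
    case False
    have "(\<Sum>r\<in>UNIV. W ((axis i (axis i 1, 0) + axis a0 ((-1) *\<^sub>R (axis a0 1, 0))) $ r) $ r) = 0"
      by (rule zero) (simp add: div_u_add div_u_axis axis_nth_if)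
    then have "W (axis i 1, 0) $ i + W ((-1) *\<^sub>R (axis a0 1, 0)) $ a0 = 0"
      by (simp only: vector_add_component W_add sum.distrib W_axis)
    then have "W (axis i 1, 0) $ i = W (axis a0 1, 0) $ a0"
      unfolding W_scale by simp
    then show ?thesis by (simp add: W_def \<mu>_def \<sigma>_def)
  qed
  have "W (y, q) $ i = \<mu> (x, v) * y $ i" for i
  proof -
    have "(y, q) = (y - y $ i *\<^sub>R axis i 1, q) + y $ i *\<^sub>R (axis i 1, 0)" by simp
    then have "W (y, q) = W (y - y $ i *\<^sub>R axis i 1, q) + y $ i *\<^sub>R W (axis i 1, 0)"
      by (metis W_add W_scale)
    then show ?thesis using off[of "y - y $ i *\<^sub>R axis i 1" i q] on[of i]
      by (simp add: axis_nth_if)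
  qed
  then have "W (y, q) = \<mu> (x, v) *\<^sub>R y" by (simp add: vec_eq_iff)
  then show ?thesis by (simp add: W_def algebra_simps)
qed

lemma f_p: "f (x, (u, p)) = f (x, (u, 0))"
  using const_along_line[of f "(0, (0, p))" "(x, (u, 0))"] f_pressure td(2)
  by (simp add: twice_diff_differentiable)

lemma D1_f_p: "D1 f (x, (u, p)) h = D1 f (x, (u, 0)) h"
proof -
  have "f (y, (w, q + p)) = f (y, (w, q))" for y w q
    by (rule trans[OF f_p f_p[symmetric]])
  then have "f (z + (0, (0, p))) = f z + 0" for z
    by (cases z) simp
  from D1_invariant[OF twice_diff_differentiable[OF td(2)] this, of "(x, (u, 0))"]
  show ?thesis by simp
qed

text \<open>The multiple turns out to be a function \<open>L\<close> of \<open>x\<close>, and \<open>c x\<close> is the value at \<open>u = 0\<close>.\<close>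

definition L :: "real^'n \<Rightarrow> real" where "L x = \<mu> (x, (0, 0))"
definition c :: "real^'n \<Rightarrow> real^'n" where "c x = f (x, (0, 0))"

lemma \<mu>_L: "\<mu> (x, (u, p)) = L x" and f_form: "f (x, (u, p)) = Z x u + L x *\<^sub>R u + c x"
proof -
  have d: "((\<lambda>u. f (x, (u, 0)) - Z x u) has_derivative (\<lambda>w. \<mu> (x, (u, 0)) *\<^sub>R w)) (at u)" for u
  proof -
    have "((\<lambda>u. (x, (u, 0))) has_derivative (\<lambda>w. (0, (w, 0)))) (at u)"
      by (intro derivative_intros)
    from diff_chain_at[OF this twice_diff_D1[OF td(2)]]
    have "((\<lambda>u. f (x, (u, 0))) has_derivative (\<lambda>w. Z x w + \<mu> (x, (u, 0)) *\<^sub>R w)) (at u)"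
      by (simp add: o_def D1_f_vertical)
    moreover have "(Z x has_derivative Z x) (at u)"
      using Z_linear linear_imp_has_derivative by blast
    ultimately show ?thesis
      by (auto dest: has_derivative_diff)
  qed
  have "\<mu> (x, (u, p)) = \<mu> (x, (u, 0))" by (simp add: \<mu>_def D1_f_p[of x u p])
  also have "\<dots> = L x"
    unfolding L_def using scalar_derivative_const(1)[OF d a0b0] .
  finally show "\<mu> (x, (u, p)) = L x" .
  have "f (x, (u, 0)) - Z x u = \<mu> (x, (0, 0)) *\<^sub>R u + (f (x, (0, 0)) - Z x 0)"
    by (rule scalar_derivative_const(2)[OF d a0b0])
  then show "f (x, (u, p)) = Z x u + L x *\<^sub>R u + c x"
    by (simp add: f_p[of x u p] L_def c_def linear_0[OF Z_linear] algebra_simps)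
qed

lemma D1_f: "D1 f (x, v) (0, m) = Z x (fst m) + L x *\<^sub>R fst m"
  using D1_f_vertical[of x v "fst m" "snd m"] \<mu>_L[of x "fst v" "snd v"] by simp

text \<open>What is left of the momentum condition once the second derivatives are eliminated and the
  forms of \<open>\<xi>\<close> and \<open>f\<close> are inserted.  The terms are grouped by their degree in \<open>v1\<close>: degree one,
  then two, then zero.\<close>

lemma momentum_condition:
  fixes x u :: "real^'n" and p :: real
  assumes v1: "div_u v1 = 0"
  defines "z \<equiv> (x, (u, p))"
  shows "L x *\<^sub>R grad_p v1 + (\<Sum>i\<in>UNIV. D2 f z (axis i 1, 0) (0, v1 $ i) + D2 f z (0, v1 $ i) (axis i 1, 0))
     - (\<Sum>i\<in>UNIV. (laplace_k x $ i + (2 * \<sigma> x + L x) * u $ i + c x $ i) *\<^sub>R fst (v1 $ i))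
     - (\<chi> j. D1 g z (0, v1 $ j))
     + (\<Sum>i\<in>UNIV. D2 f z (0, v1 $ i) (0, v1 $ i))
     + ((\<Sum>i\<in>UNIV. D2 f z (axis i 1, 0) (axis i 1, 0)) - (\<chi> j. D1 g z (axis j 1, 0))
       - (\<Sum>i\<in>UNIV. u $ i *\<^sub>R D1 f z (axis i 1, 0))) = 0"
proof -
  define F where "F = grad_p v1 + convection u v1"
  define v2 :: "(('n vp, 'n) vec, 'n) vec" where "v2 = axis a0 (axis a0 (F, 0))"
  have "fst (v2 $ i $ i) = (if i = a0 then F else 0)" for i
    by (simp add: v2_def axis_nth_if)
  then have "(\<Sum>i\<in>UNIV. fst (v2 $ i $ i)) = grad_p v1 + convection u v1"
    by (simp add: F_def)
  then have 0: "second_part z v1 v2 + lower_part z v1 = 0"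
    unfolding z_def using v1 by (intro ext_momentum_zero) (simp_all add: v2_def axis_nth_if)
  have ZF: "Z x F = Z x (grad_p v1) + (\<Sum>i\<in>UNIV. u $ i *\<^sub>R Z x (fst (v1 $ i)))"
    by (simp add: F_def convection_def linear_add[OF Z_linear] linear_sum[OF Z_linear] linear_cmul[OF Z_linear])
  have 1: "second_part z v1 v2 = Z x (grad_p v1) + (\<Sum>i\<in>UNIV. u $ i *\<^sub>R Z x (fst (v1 $ i))) + (L x - 2 * \<sigma> x) *\<^sub>R F"
    unfolding v2_def second_part_axis z_def
    by (simp add: D1_k D1_f ZF \<sigma>_def[symmetric] linear_0[OF Z_linear] algebra_simps)
  have A1: "(\<Sum>i\<in>UNIV. D2 f z (axis i 1, v1 $ i) (axis i 1, v1 $ i)) =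
     (\<Sum>i\<in>UNIV. D2 f z (axis i 1, 0) (axis i 1, 0))
     + (\<Sum>i\<in>UNIV. D2 f z (axis i 1, 0) (0, v1 $ i) + D2 f z (0, v1 $ i) (axis i 1, 0))
     + (\<Sum>i\<in>UNIV. D2 f z (0, v1 $ i) (0, v1 $ i))"
  proof -
    have "D2 f z (a, m) (a, m) = D2 f z (a, 0) (a, 0) + (D2 f z (a, 0) (0, m) + D2 f z (0, m) (a, 0)) + D2 f z (0, m) (0, m)" for a m
    proof -
      have "D2 f z ((a, 0) + (0, m)) ((a, 0) + (0, m)) = D2 f z (a, 0) (a, 0) + (D2 f z (a, 0) (0, m) + D2 f z (0, m) (a, 0)) + D2 f z (0, m) (0, m)"
        unfolding linear_add[OF D2_linear[OF td(2)]] linear_add[OF D2_linear_right[OF td(2)]]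
        by (simp add: algebra_simps)
      then show ?thesis by simp
    qed
    then have "D2 f z (axis i 1, v1 $ i) (axis i 1, v1 $ i) = D2 f z (axis i 1, 0) (axis i 1, 0)
      + (D2 f z (axis i 1, 0) (0, v1 $ i) + D2 f z (0, v1 $ i) (axis i 1, 0)) + D2 f z (0, v1 $ i) (0, v1 $ i)" for i .
    then show ?thesis by (simp only: sum.distrib)
  qed
  have A2: "(\<Sum>i\<in>UNIV. \<Sum>l\<in>UNIV. D2 k z (axis i 1, v1 $ i) (axis i 1, v1 $ i) $ l *\<^sub>R fst (v1 $ l))
     = (\<Sum>l\<in>UNIV. laplace_k x $ l *\<^sub>R fst (v1 $ l))"
  proof -
    have "D2 k z (axis i 1, v1 $ i) (axis i 1, v1 $ i) = D2 k (x, 0) (axis i 1, 0) (axis i 1, 0)" for i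
      unfolding z_def by (rule D2_k)
    then show ?thesis
      by (simp only:) (subst sum.swap, simp add: laplace_k_def scaleR_sum_left)
  qed
  have A3: "(\<chi> j. D1 g z (axis j 1, v1 $ j) - (\<Sum>l\<in>UNIV. D1 k z (axis j 1, v1 $ j) $ l * snd (v1 $ l)))
     = (\<chi> j. D1 g z (axis j 1, 0)) + (\<chi> j. D1 g z (0, v1 $ j)) - (2 * \<sigma> x) *\<^sub>R grad_p v1 + Z x (grad_p v1)"
  proof -
    have "(\<Sum>l\<in>UNIV. Z x (axis j 1) $ l * snd (v1 $ l)) = 2 * \<sigma> x * grad_p v1 $ j - Z x (grad_p v1) $ j" for j
    proof -
      have "(\<Sum>l\<in>UNIV. Z x (axis j 1) $ l * snd (v1 $ l)) = Z x (axis j 1) \<bullet> grad_p v1"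
        by (simp add: inner_vec_def grad_p_def)
      also have "\<dots> = 2 * \<sigma> x * (axis j 1 \<bullet> grad_p v1) - Z x (grad_p v1) \<bullet> axis j 1"
        using Z_conformal[of x "axis j 1" "grad_p v1"] by simp
      finally show ?thesis by (simp add: inner_axis inner_axis')
    qed
    moreover have "D1 g z (axis j 1, v1 $ j) = D1 g z (axis j 1, 0) + D1 g z (0, v1 $ j)" for j
      by (rule D1_split[OF lin(3)])
    ultimately show ?thesis
      unfolding z_def D1_k by (simp add: vec_eq_iff)
  qed
  have Zu: "(\<Sum>i\<in>UNIV. u $ i *\<^sub>R (\<Sum>l\<in>UNIV. Z x (axis i 1) $ l *\<^sub>R fst (v1 $ l))) = (\<Sum>l\<in>UNIV. Z x u $ l *\<^sub>R fst (v1 $ l))"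
    unfolding Z_sum[of x u] scaleR_sum_right by (subst sum.swap) (simp add: scaleR_sum_left)
  have A4: "(\<Sum>i\<in>UNIV. fst (snd z) $ i *\<^sub>R (D1 f z (axis i 1, v1 $ i) - (\<Sum>l\<in>UNIV. D1 k z (axis i 1, v1 $ i) $ l *\<^sub>R fst (v1 $ l))))
     = (\<Sum>i\<in>UNIV. u $ i *\<^sub>R D1 f z (axis i 1, 0)) + (\<Sum>i\<in>UNIV. u $ i *\<^sub>R Z x (fst (v1 $ i)))
       + L x *\<^sub>R convection u v1 - (\<Sum>l\<in>UNIV. Z x u $ l *\<^sub>R fst (v1 $ l))"
  proof -
    have s: "D1 f z (axis i 1, v1 $ i) = D1 f z (axis i 1, 0) + (Z x (fst (v1 $ i)) + L x *\<^sub>R fst (v1 $ i))" for i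
      using D1_split[OF lin(2), of z "axis i 1" "v1 $ i"] D1_f[of x "(u, p)" "v1 $ i"]
      by (simp add: z_def)
    show ?thesis
      using Zu
      unfolding s unfolding z_def D1_k
      by (simp add: convection_def scaleR_add_right scaleR_diff_right sum.distrib sum_subtractf
          scaleR_sum_right[of "L x"] mult.commute)
  qed
  have A5: "(\<Sum>i\<in>UNIV. f z $ i *\<^sub>R fst (v1 $ i)) = (\<Sum>l\<in>UNIV. Z x u $ l *\<^sub>R fst (v1 $ l)) + L x *\<^sub>R convection u v1
      + (\<Sum>i\<in>UNIV. c x $ i *\<^sub>R fst (v1 $ i))"
    unfolding z_def f_form
    by (simp add: convection_def scaleR_add_left sum.distrib scaleR_sum_right)
  have A6: "(\<Sum>i\<in>UNIV. (laplace_k x $ i + (2 * \<sigma> x + L x) * u $ i + c x $ i) *\<^sub>R fst (v1 $ i)) =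
      (\<Sum>l\<in>UNIV. laplace_k x $ l *\<^sub>R fst (v1 $ l)) + (2 * \<sigma> x + L x) *\<^sub>R convection u v1 + (\<Sum>i\<in>UNIV. c x $ i *\<^sub>R fst (v1 $ i))"
    by (simp add: convection_def scaleR_add_left sum.distrib scaleR_sum_right distrib_right)
  \<comment> \<open>With \<open>q\<close> the pressure gradient, \<open>S\<close> the convective term and \<open>s = 2 \<sigma>\<close>, the rest is linear
    algebra with these abbreviations; all terms in \<open>Z\<close> cancel.\<close>
  have "(Zq + ZS + (l - s) *\<^sub>R (q + S)) + (d1 + d2 + d3 - zz - (G1 + G2 - s *\<^sub>R q + Zq)
        - (u1 + ZS + l *\<^sub>R S - Zu) - (Zu + l *\<^sub>R S + cc))
      = l *\<^sub>R q + d2 - (zz + (s + l) *\<^sub>R S + cc) - G2 + d3 + (d1 - G1 - u1)"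
    for Zq ZS q S d1 d2 d3 zz G1 G2 u1 Zu cc :: "real^'n" and l s
    by (simp add: vec_eq_iff algebra_simps)
  then show ?thesis
    using 0 unfolding 1 lower_part_def A1 A2 A3 A4 A5 A6 F_def by (simp only:)
qed

subsection \<open>Consequences of the momentum condition\<close>

text \<open>The terms of first order in \<open>v1\<close> and those of order zero vanish separately, since \<open>v1\<close> may be
  replaced by \<open>- v1\<close> and by \<open>0\<close>.\<close>

lemma momentum_first_order:
  assumes v1: "div_u v1 = 0"
  shows "L x *\<^sub>R grad_p v1
     + (\<Sum>i\<in>UNIV. D2 f (x, (u, p)) (axis i 1, 0) (0, v1 $ i) + D2 f (x, (u, p)) (0, v1 $ i) (axis i 1, 0))
     - (\<Sum>i\<in>UNIV. (laplace_k x $ i + (2 * \<sigma> x + L x) * u $ i + c x $ i) *\<^sub>R fst (v1 $ i))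
     - (\<chi> j. D1 g (x, (u, p)) (0, v1 $ j)) = 0" (is ?first)
  and momentum_zeroth_order:
    "(\<Sum>i\<in>UNIV. D2 f (x, (u, p)) (axis i 1, 0) (axis i 1, 0)) - (\<chi> j. D1 g (x, (u, p)) (axis j 1, 0))
       - (\<Sum>i\<in>UNIV. u $ i *\<^sub>R D1 f (x, (u, p)) (axis i 1, 0)) = 0" (is ?zeroth)
proof -
  define z where "z = (x, (u, p))"
  define B where "B v = L x *\<^sub>R grad_p v
     + (\<Sum>i\<in>UNIV. D2 f z (axis i 1, 0) (0, v $ i) + D2 f z (0, v $ i) (axis i 1, 0))
     - (\<Sum>i\<in>UNIV. (laplace_k x $ i + (2 * \<sigma> x + L x) * u $ i + c x $ i) *\<^sub>R fst (v $ i))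
     - (\<chi> j. D1 g z (0, v $ j))" for v :: "('n vp, 'n) vec"
  define Q where "Q v = (\<Sum>i\<in>UNIV. D2 f z (0, v $ i) (0, v $ i))" for v :: "('n vp, 'n) vec"
  define C where "C = (\<Sum>i\<in>UNIV. D2 f z (axis i 1, 0) (axis i 1, 0)) - (\<chi> j. D1 g z (axis j 1, 0))
       - (\<Sum>i\<in>UNIV. u $ i *\<^sub>R D1 f z (axis i 1, 0))"
  have sum: "B v + Q v + C = 0" if "div_u v = 0" for v
    using momentum_condition[OF that, of x u p] unfolding B_def Q_def C_def z_def .
  have n1: "D2 f z h (0, - m) = - D2 f z h (0, m)" for h m
    using linear_neg[OF D2_linear_right[OF td(2)], of z h "(0, m)"] by simp
  have n2: "D2 f z (0, - m) h = - D2 f z (0, m) h" for h m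
    using linear_neg[OF D2_linear[OF td(2)], of z "(0, m)" h] by simp
  have n3: "D1 g z (0, - m) = - D1 g z (0, m)" for m
    using linear_neg[OF lin(3), of z "(0, m)"] by simp
  have "B (- v) $ i = - (B v) $ i" for v i
    by (simp add: B_def grad_p_def n1 n2 n3 sum_negf sum_component sum.distrib sum_subtractf)
  then have B: "B (- v) = - B v" for v by (simp add: vec_eq_iff)
  have Q: "Q (- v) = Q v" for v by (simp add: Q_def n1 n2)
  have "div_u (- v1) = 0" using v1 by (simp add: div_u_minus)
  have "2 *\<^sub>R B v1 = (B v1 + Q v1 + C) - (B (- v1) + Q (- v1) + C)"
    by (simp add: B Q scaleR_2)
  then have "2 *\<^sub>R B v1 = 0"
    using sum[OF v1] sum[OF \<open>div_u (- v1) = 0\<close>] by simp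
  then have B0: "B v1 = 0" by simp
  then show ?first by (simp add: B_def z_def)
  have "(0 :: ('n vp, 'n) vec) = - 0" by simp
  then have "B 0 = - B 0" using B[of 0] by metis
  then have "2 *\<^sub>R B 0 = 0" by (metis scaleR_2 add.right_inverse)
  then have "B 0 = 0" by simp
  moreover have "Q 0 = 0"
    using linear_0[OF D2_linear[OF td(2)], of z "0"] by (simp add: Q_def zero_prod_def)
  ultimately have "C = 0" using sum[OF div_u_zero] by simp
  then show ?zeroth by (simp add: C_def z_def)
qed

lemma D2_f_p_right: "D2 f z h (0, (0, q)) = 0"
  unfolding D2_def f_pressure by (rule D1_eqI) (rule has_derivative_const)

lemma D2_f_p_left: "D2 f z (0, (0, q)) h = 0"
  unfolding D2_def
proof (rule D1_along_invariant[OF twice_diff_D1_differentiable[OF td(2)]])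
  fix t
  obtain x u p where z: "z = (x, (u, p))" by (metis prod.collapse)
  have "D1 f (x, (u, p + t * q)) h = D1 f (x, (u, p)) h"
    by (rule trans[OF D1_f_p D1_f_p[symmetric]])
  then show "D1 f (z + t *\<^sub>R (0, 0, q)) h = D1 f z h" by (simp add: z)
qed

text \<open>Testing the terms of degree one with a pressure gradient.\<close>

lemma g_pressure: "D1 g (x, v) (0, (0, q)) = L x * q"
proof -
  obtain u p where v: "v = (u, p)" by fastforce
  let ?v1 = "axis a0 (0, 1) :: ('n vp, 'n) vec"
  have e: "?v1 $ i = (0, if i = a0 then 1 else 0)" for i
    by (simp add: axis_nth_if zero_prod_def)
  have "div_u ?v1 = 0" by (simp add: div_u_axis)
  from momentum_first_order[OF this, of x u p]
  have "L x *\<^sub>R grad_p ?v1 - (\<chi> j. D1 g (x, v) (0, ?v1 $ j)) = 0"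
    by (simp add: e D2_f_p_left D2_f_p_right v)
  then have "(L x *\<^sub>R grad_p ?v1 - (\<chi> j. D1 g (x, v) (0, ?v1 $ j))) $ a0 = 0" by simp
  then have "D1 g (x, v) (0, (0, 1)) = L x"
    by (simp add: e grad_p_def)
  then show ?thesis using linear_cmul[OF lin(3), of "(x, v)" q "(0, (0, 1))"] by (simp add: mult.commute)
qed

lemma g_form: "g (x, (u, p)) = g (x, (u, 0)) + L x * p"
proof -
  have "((\<lambda>t. g ((x, (u, 0)) + t *\<^sub>R (0, (0, 1))) - t *\<^sub>R L x) has_derivative (\<lambda>s. 0)) (at t within UNIV)" for t :: real
  proof -
    have "((\<lambda>t. g ((x, (u, 0)) + t *\<^sub>R (0, (0, 1)))) has_derivative (\<lambda>s. s *\<^sub>R L x)) (at t)"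
      using has_derivative_along_line[of g _ "(x, (u, 0))" t "(0, (0, 1))", OF twice_diff_D1[OF td(3)]]
      by (simp add: g_pressure mult.commute)
    from has_derivative_diff[OF this has_derivative_scaleR_left[OF has_derivative_ident, of "L x"]]
    show ?thesis by simp
  qed
  then have "\<exists>r. \<forall>t\<in>UNIV. g ((x, (u, 0)) + t *\<^sub>R (0, (0, 1))) - t *\<^sub>R L x = r"
    by (intro has_derivative_zero_constant) auto
  then obtain r where "g ((x, (u, 0)) + t *\<^sub>R (0, (0, 1))) - t *\<^sub>R L x = r" for t by blast
  from this[of p] this[of 0] show ?thesis by (simp add: algebra_simps)
qed

lemma D1_expand:
  fixes F :: "'n point \<Rightarrow> 'b::real_normed_vector"
  assumes "linear (D1 F z)"
  shows "D1 F z (a, 0) = (\<Sum>j\<in>UNIV. a $ j *\<^sub>R D1 F z (axis j 1, 0))"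
proof -
  have "(a, 0) = (\<Sum>j\<in>UNIV. a $ j *\<^sub>R (axis j 1, 0 :: 'n vp))"
    using vec_expand[of a] by (simp add: prod_eq_iff fst_sum snd_sum)
  then show ?thesis by (simp only: linear_sum[OF assms] linear_cmul[OF assms])
qed

text \<open>Among the terms of degree zero only the gradient of \<open>g\<close> in \<open>x\<close>, where \<open>g = g\<^sub>0 + L p\<close>, can depend
  on \<open>p\<close>.  As they sum to zero, the gradient of \<open>L\<close> vanishes.\<close>

lemma L_const: "L x = L 0"
proof -
  have D2p: "D2 f (x, (u, p)) h h' = D2 f (x, (u, 0)) h h'" for x u p h h'
  proof -
    have "D1 f (y, (w, q + p)) h' = D1 f (y, (w, q)) h'" for y w q
      by (rule trans[OF D1_f_p D1_f_p[symmetric]])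
    then have "D1 f (z + (0, (0, p))) h' = D1 f z h' + 0" for z
      by (cases z) simp
    from D1_invariant[OF twice_diff_D1_differentiable[OF td(2)] this, of "(x, (u, 0))" h]
    show ?thesis by (simp add: D2_def)
  qed
  have "D1 g (x, (0, 1)) (axis j 1, 0) = D1 g (x, (0, 0)) (axis j 1, 0)" for x j
  proof -
    have "(\<chi> j. D1 g (x, (0, 1)) (axis j 1, 0)) = (\<chi> j. D1 g (x, (0, 0)) (axis j 1, 0))"
      using momentum_zeroth_order[OF div_u_zero, of x 0 1] momentum_zeroth_order[OF div_u_zero, of x 0 0]
      by (simp add: D2p[of x 0 1] D1_f_p[of x 0 1])
    then show ?thesis by (simp add: vec_eq_iff)
  qed
  then have D: "D1 g (x, (0, 1)) (a, 0) = D1 g (x, (0, 0)) (a, 0)" for x a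
    by (simp add: D1_expand[OF lin(3), of _ a])
  have "(L has_derivative (\<lambda>a. 0)) (at x within UNIV)" for x
  proof -
    have "((\<lambda>x. (x, v)) has_derivative (\<lambda>a. (a, 0))) (at x)" for v :: "'n vp"
      by (intro derivative_intros)
    from diff_chain_at[OF this twice_diff_D1[OF td(3)]]
    have d: "((\<lambda>x. g (x, v)) has_derivative (\<lambda>a. D1 g (x, v) (a, 0))) (at x)" for v
      by (simp add: o_def)
    have "L = (\<lambda>x. g (x, (0, 1)) - g (x, (0, 0)))"
      using g_form[of _ 0 1] by (simp add: fun_eq_iff)
    moreover have "((\<lambda>x. g (x, (0, 1)) - g (x, (0, 0))) has_derivative (\<lambda>a. 0)) (at x)"
      using has_derivative_diff[OF d[of "(0, 1)"] d[of "(0, 0)"]] by (simp add: D)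
    ultimately show ?thesis by simp
  qed
  then have "\<exists>r. \<forall>x\<in>UNIV. L x = r"
    by (intro has_derivative_zero_constant) auto
  then show ?thesis by auto
qed

text \<open>Testing the terms of degree one with the trace-free velocity gradient \<open>D\<^sub>i u = e\<^sub>j\<close>.\<close>

lemma momentum_axis:
  assumes ij: "i \<noteq> j"
  defines "e \<equiv> (axis j 1, 0) :: 'n vp"
  shows "D2 f (x, (u, p)) (axis i 1, 0) (0, e) + D2 f (x, (u, p)) (0, e) (axis i 1, 0)
     - (laplace_k x $ i + (2 * \<sigma> x + L x) * u $ i + c x $ i) *\<^sub>R axis j 1
     - axis i (D1 g (x, (u, p)) (0, e)) = 0"
proof -
  let ?v1 = "axis i e" and ?z = "(x, (u, p))"
  have "div_u ?v1 = 0" using ij by (simp add: div_u_axis e_def axis_nth_if)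
  note first = momentum_first_order[OF this, of x u p]
  have g0: "grad_p ?v1 = 0"
    by (simp add: grad_p_def e_def axis_nth_if vec_eq_iff)
  have "D2 f ?z (axis r 1, 0) (0, ?v1 $ r) + D2 f ?z (0, ?v1 $ r) (axis r 1, 0)
     = (if r = i then D2 f ?z (axis i 1, 0) (0, e) + D2 f ?z (0, e) (axis i 1, 0) else 0)" for r
    using linear_0[OF D2_linear[OF td(2)], of ?z "(axis r 1, 0)"] linear_0[OF D2_linear_right[OF td(2)], of ?z "(axis r 1, 0)"]
    by (simp add: axis_nth_if zero_prod_def)
  then have s1: "(\<Sum>r\<in>UNIV. D2 f ?z (axis r 1, 0) (0, ?v1 $ r) + D2 f ?z (0, ?v1 $ r) (axis r 1, 0))
     = D2 f ?z (axis i 1, 0) (0, e) + D2 f ?z (0, e) (axis i 1, 0)" by simp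
  have "(laplace_k x $ r + (2 * \<sigma> x + L x) * u $ r + c x $ r) *\<^sub>R fst (?v1 $ r)
     = (if r = i then (laplace_k x $ i + (2 * \<sigma> x + L x) * u $ i + c x $ i) *\<^sub>R axis j 1 else 0)" for r
    by (simp add: axis_nth_if e_def)
  then have s2: "(\<Sum>r\<in>UNIV. (laplace_k x $ r + (2 * \<sigma> x + L x) * u $ r + c x $ r) *\<^sub>R fst (?v1 $ r))
     = (laplace_k x $ i + (2 * \<sigma> x + L x) * u $ i + c x $ i) *\<^sub>R axis j 1" by simp
  have s3: "(\<chi> r. D1 g ?z (0, ?v1 $ r)) = axis i (D1 g ?z (0, e))"
    using linear_0[OF lin(3), of ?z] by (simp add: vec_eq_iff axis_nth_if zero_prod_def)
  show ?thesis using first unfolding g0 s1 s2 s3 by simp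
qed

lemma D2_f_mixed_right: "D2 f (x, v) (a, m') (0, m) = D2 f (x, 0) (a, 0) (0, m)"
  unfolding D2_def
  by (rule D1_fst_only[OF twice_diff_D1_differentiable[OF td(2)]]) (simp add: D1_f)

text \<open>The map \<open>f\<close> is affine in \<open>u\<close>; translating \<open>u\<close> changes it by a function of \<open>x\<close>.  Hence the
  derivative in \<open>u\<close> of its derivatives in \<open>x\<close> does not depend on \<open>u\<close>.\<close>

lemma D2_f_mixed_left: "D2 f (x, (u, 0)) (0, m) (a, 0) = D2 f (x, 0) (0, m) (a, 0)"
proof -
  define d :: "'n point" where "d = (0, (u, 0))"
  have H': "((\<lambda>y. f (y + d) - f y) has_derivative (\<lambda>h. D1 f (y + d) h - D1 f y h)) (at y)" for y
    by (intro has_derivative_diff has_derivative_translate twice_diff_D1 td)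
  then have H: "(\<lambda>y. f (y + d) - f y) differentiable (at y)" for y
    using differentiable_def by blast
  have "f ((x, v) + d) - f (x, v) = f ((x, 0) + d) - f (x, 0)" for x v
    by (cases v) (simp add: d_def f_form zero_prod_def linear_add[OF Z_linear] linear_0[OF Z_linear] algebra_simps)
  from D1_fst_only[OF H this]
  have inv: "D1 f ((x, v) + d) (a, 0) - D1 f (x, v) (a, 0) = D1 f ((x, 0) + d) (a, 0) - D1 f (x, 0) (a, 0)" for x v
    unfolding D1_eqI[OF H'] .
  have der: "((\<lambda>y. D1 f (y + d) (a, 0) - D1 f y (a, 0)) has_derivative
     (\<lambda>h. D2 f ((x, 0) + d) h (a, 0) - D2 f (x, 0) h (a, 0))) (at (x, 0))"
    by (intro has_derivative_diff has_derivative_translate twice_diff_D2 td)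
  have "D1 (\<lambda>y. D1 f (y + d) (a, 0) - D1 f y (a, 0)) (x, 0) (0, m) = 0"
  proof (rule D1_along_invariant)
    show "(\<lambda>y. D1 f (y + d) (a, 0) - D1 f y (a, 0)) differentiable at (x, 0)"
      using der differentiable_def by blast
    show "D1 f ((x, 0) + t *\<^sub>R (0, m) + d) (a, 0) - D1 f ((x, 0) + t *\<^sub>R (0, m)) (a, 0)
       = D1 f ((x, 0) + d) (a, 0) - D1 f (x, 0) (a, 0)" for t
      using inv[of x "t *\<^sub>R m"] by simp
  qed
  then show ?thesis unfolding D1_eqI[OF der] by (simp add: d_def)
qed

text \<open>In the \<open>j\<close>-th component of \<open>momentum_axis\<close> the coefficient of \<open>u\<^sub>i\<close> is \<open>- (2 \<sigma> + L)\<close>, all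
  other terms being independent of \<open>u\<close>.\<close>

lemma \<sigma>_const: "\<sigma> x = - L 0 / 2"
proof -
  note m = momentum_axis[OF a0b0, of x _ 0]
  have "((2 * \<sigma> x + L x) * (axis a0 1 :: real^'n) $ a0) *\<^sub>R (axis b0 1 :: real^'n) $ b0
      = (D2 f (x, (axis a0 1, 0)) (axis a0 1, 0) (0, (axis b0 1, 0)) + D2 f (x, (axis a0 1, 0)) (0, (axis b0 1, 0)) (axis a0 1, 0)) $ b0
      - (D2 f (x, (0, 0)) (axis a0 1, 0) (0, (axis b0 1, 0)) + D2 f (x, (0, 0)) (0, (axis b0 1, 0)) (axis a0 1, 0)) $ b0"
    using arg_cong[OF m[of "axis a0 1"], of "\<lambda>w. w $ b0"] arg_cong[OF m[of 0], of "\<lambda>w. w $ b0"] a0b0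
    by (simp add: axis_nth_if)
  also have "\<dots> = 0"
    by (simp add: D2_f_mixed_left D2_f_mixed_right[of x "(axis a0 1, 0)"] zero_prod_def[symmetric])
  finally show ?thesis using L_const[of x] by (simp add: axis_nth_if)
qed

text \<open>As \<open>\<sigma>\<close> is constant, \<open>\<xi> - \<sigma> x\<close> is a Killing field and \<open>\<xi>\<close> is affine.  The Laplacian of
  \<open>\<xi>\<close> and the mixed derivatives of \<open>f\<close> then drop out of the momentum condition, which leaves no
  room for further terms in \<open>\<eta>\<close>.\<close>

lemma symmetry_form:
  obtains A s d e where "transpose A = - A" and "\<And>x u p. X (x, (u, p)) = (A *v x + s *\<^sub>R x + d, A *v u - s *\<^sub>R u, - 2 * s * p + e)"
proof -
  define s where "s = - L 0 / 2"
  have L: "L x = - 2 * s" for x using L_const[of x] by (simp add: s_def)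
  have k1: "((\<lambda>x. k (x, 0)) has_derivative Z x) (at x)" for x
  proof -
    have "((\<lambda>x. (x, 0)) has_derivative (\<lambda>a. (a, 0))) (at x)"
      by (intro derivative_intros)
    from diff_chain_at[OF this twice_diff_D1[OF td(1)]]
    show ?thesis by (simp add: o_def Z_def[abs_def])
  qed
  have "((\<lambda>x. k (x, 0) - s *\<^sub>R x) has_derivative (\<lambda>a. Z x a - s *\<^sub>R a)) (at x)" for x
    by (intro derivative_intros k1)
  moreover have "(Z x a - s *\<^sub>R a) \<bullet> a = 0" for x a
    using Z_conformal[of x a a] \<sigma>_const[of x] by (simp add: inner_diff_left inner_add_left s_def)
  ultimately obtain A where A: "transpose A = - A"
    and kA: "\<And>x. k (x, 0) - s *\<^sub>R x = A *v x + (k (0, 0) - s *\<^sub>R 0)"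
    by (rule killing_affine) blast
  define d where "d = k (0, 0)"
  have kform: "k (x, v) = A *v x + s *\<^sub>R x + d" for x v
    using kA[of x] k_fst[of x v] by (simp add: d_def algebra_simps)
  have ZA: "Z x a = A *v a + s *\<^sub>R a" for x a
  proof -
    have "((\<lambda>x. A *v x + s *\<^sub>R x + d) has_derivative (\<lambda>a. A *v a + s *\<^sub>R a + 0)) (at x)"
      by (intro derivative_intros linear_imp_has_derivative) simp
    then have "((\<lambda>x. k (x, 0)) has_derivative (\<lambda>a. A *v a + s *\<^sub>R a + 0)) (at x)"
      by (simp add: kform)
    with k1[of x] have "Z x = (\<lambda>a. A *v a + s *\<^sub>R a + 0)" by (rule has_derivative_unique)
    then show ?thesis by simp
  qed
  have ff: "f (x, (u, p)) = A *v u - s *\<^sub>R u + c x" for x u p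
    using scaleR_2[of "s *\<^sub>R u"] by (simp add: f_form ZA L algebra_simps)
  have const0: "D1 (\<lambda>y. r) z h = 0" for r :: "real^'n" and z h :: "'n point"
    by (rule D1_eqI) (rule has_derivative_const)
  have DR: "D2 f z h (0, m) = 0" for z h m
  proof -
    have "(\<lambda>y. D1 f y (0, m)) = (\<lambda>y. A *v fst m + s *\<^sub>R fst m + (- 2 * s) *\<^sub>R fst m)"
    proof
      fix y show "D1 f y (0, m) = A *v fst m + s *\<^sub>R fst m + (- 2 * s) *\<^sub>R fst m"
        using D1_f[of "fst y" "snd y" m] by (simp add: ZA L)
    qed
    then show ?thesis by (simp add: D2_def const0)
  qed
  have DL: "D2 f z (0, m) h = 0" for z m h
    unfolding D2_def
  proof (rule D1_along_invariant[OF twice_diff_D1_differentiable[OF td(2)]])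
    fix t
    have "f (y + t *\<^sub>R (0, m)) = f y + (A *v (t *\<^sub>R fst m) - s *\<^sub>R t *\<^sub>R fst m)" for y
      by (cases y, cases m) (simp add: ff matrix_vector_right_distrib algebra_simps)
    from D1_invariant[OF twice_diff_differentiable[OF td(2)] this]
    show "D1 f (z + t *\<^sub>R (0, m)) h = D1 f z h" .
  qed
  have laplace_k0: "laplace_k x = 0" for x
  proof -
    have "(\<lambda>y. D1 k y (b, 0)) = (\<lambda>y. A *v b + s *\<^sub>R b)" for b
    proof
      fix y show "D1 k y (b, 0) = A *v b + s *\<^sub>R b"
        using D1_k[of "fst y" "snd y" b 0] by (simp add: ZA)
    qed
    then show ?thesis by (simp add: laplace_k_def D2_def const0)
  qed
  have ax: "c x $ i = 0 \<and> D1 g (x, (u, p)) (0, (axis j 1, 0)) = 0" if "i \<noteq> j" for x u p i j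
  proof -
    have sL: "2 * \<sigma> x + L x = 0" using \<sigma>_const[of x] L_const[of x] by simp
    have *: "- (c x $ i *\<^sub>R axis j 1) - axis i (D1 g (x, (u, p)) (0, (axis j 1, 0))) = 0"
      using momentum_axis[OF that, of x u p] by (simp add: DR DL laplace_k0 sL)
    show ?thesis
      using arg_cong[OF *, of "\<lambda>w. w $ j"] arg_cong[OF *, of "\<lambda>w. w $ i"] that
      by (simp add: axis_nth_if)
  qed
  have other: "\<exists>j. j \<noteq> i" for i :: 'n using a0b0 by metis
  have c0: "c x = 0" for x
    using ax other by (simp add: vec_eq_iff) metis
  have gu: "D1 g (x, (u, p)) (0, (axis j 1, 0)) = 0" for x u p j
    using ax other[of j] by metis
  have f0: "D1 f z (a, 0) = 0" for z a
  proof (rule D1_along_invariant[OF twice_diff_differentiable[OF td(2)]])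
    fix t show "f (z + t *\<^sub>R (a, 0)) = f z" by (cases z) (auto simp: ff c0 zero_prod_def)
  qed
  have gx: "D1 g (x, (u, p)) (axis j 1, 0) = 0" for x u p j
  proof -
    have "(\<chi> j. D1 g (x, (u, p)) (axis j 1, 0)) = 0"
      using momentum_zeroth_order[OF div_u_zero, of x u p] by (simp add: f0 D2_def const0)
    then show ?thesis by (simp add: vec_eq_iff)
  qed
  have "D1 g z (a, (y, 0)) = 0" for z a y
  proof -
    obtain x u p where z: "z = (x, (u, p))" by (metis prod.collapse)
    have "(a, (y, 0 :: real)) = (a, 0) + (\<Sum>j\<in>UNIV. y $ j *\<^sub>R (0, (axis j 1, 0)))"
      using vec_expand[of y] by (simp add: prod_eq_iff fst_sum snd_sum)
    then have "D1 g z (a, (y, 0)) = D1 g z (a, 0) + (\<Sum>j\<in>UNIV. y $ j *\<^sub>R D1 g z (0, (axis j 1, 0)))"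
      by (simp only: linear_add[OF lin(3)] linear_sum[OF lin(3)] linear_cmul[OF lin(3)])
    then show ?thesis using D1_expand[OF lin(3), of z a] by (simp add: z gx gu)
  qed
  then have g0: "g (0 + (x, (u, 0))) = g 0" for x u
    by (intro const_along_line twice_diff_differentiable td)
  define e where "e = g 0"
  have gg: "g (x, (u, p)) = - 2 * s * p + e" for x u p
    using g0[of x u] by (simp add: g_form[of x u p] L e_def)
  have "X z = (k z, (f z, g z))" for z
    by (simp add: k_def f_def g_def \<xi>_def \<eta>_def)
  then have "X (x, (u, p)) = (A *v x + s *\<^sub>R x + d, A *v u - s *\<^sub>R u, - 2 * s * p + e)" for x u p
    by (simp add: kform ff c0 gg)
  with A show ?thesis by (rule that)
qed

end

section \<open>The space of symmetries\<close>

text \<open>The general linear combination of the generators: the rotation \<open>A\<close>, the scaling \<open>s\<close>, the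
  translation \<open>d\<close> and the pressure shift \<open>e\<close>.\<close>

definition sim_gen :: "real^'n^'n \<Rightarrow> real \<Rightarrow> real^'n \<Rightarrow> real \<Rightarrow> 'n::finite vfield" where
  "sim_gen A s d e = (\<lambda>(x, u, p). (A *v x + s *\<^sub>R x + d, A *v u - s *\<^sub>R u, - 2 * s * p + e))"

lemma has_derivative_affine:
  fixes T :: "'a::euclidean_space \<Rightarrow> 'b::real_normed_vector"
  assumes "linear T" and F: "F = (\<lambda>z. T z + b)"
  shows "(F has_derivative T) (at z)"
  using has_derivative_add[OF linear_imp_has_derivative[OF assms(1)] has_derivative_const[of b]]
  by (simp add: F)

lemma smooth_affine:
  fixes T :: "'a::euclidean_space \<Rightarrow> 'b::real_normed_vector"
  assumes T: "linear T" and F: "F = (\<lambda>z. T z + b)"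
  shows "smooth F"
proof -
  have const: "Ck k (\<lambda>z::'a. r::'b)" for k r
    by (induction k arbitrary: r) (auto simp: frechet_derivative_const)
  note der = has_derivative_affine[OF T F]
  have "Ck k F" for k
  proof (cases k)
    case 0
    have "continuous_on UNIV F"
      by (intro continuous_at_imp_continuous_on ballI has_derivative_continuous[OF der])
    then show ?thesis using 0 by simp
  next
    case (Suc m)
    have "frechet_derivative F (at z) = T" for z
      using frechet_derivative_at[OF der] by simp
    moreover have "F differentiable (at z)" for z
      using der differentiable_def by blast
    ultimately show ?thesis using Suc const by simp
  qed
  then show ?thesis by (simp add: smooth_def)
qed

lemma \<xi>_sim_gen: "\<xi> (sim_gen A s d e) = (\<lambda>z. (A *v fst z + s *\<^sub>R fst z) + d)"
  by (auto simp: \<xi>_def sim_gen_def fun_eq_iff)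

lemma \<eta>_sim_gen:
  "\<eta> (sim_gen A s d e) = (\<lambda>z. (A *v fst (snd z) - s *\<^sub>R fst (snd z), - 2 * s * snd (snd z)) + (0, e))"
  by (auto simp: \<eta>_def sim_gen_def fun_eq_iff)

lemma linear_sim_gen:
  "linear (\<lambda>z :: 'n::finite point. A *v fst z + s *\<^sub>R fst z)"
  "linear (\<lambda>z :: 'n::finite point. (A *v fst (snd z) - s *\<^sub>R fst (snd z), - 2 * s * snd (snd z)))"
  by (auto intro!: linearI simp: matrix_vector_right_distrib scaleR_add_right
      matrix_vector_mult_scaleR scaleR_diff_right algebra_simps)

lemma skew_nth: "transpose A = - A \<Longrightarrow> A $ j $ i = - (A $ i $ j)" for A :: "real^'n^'n::finite"
  by (drule arg_cong[where f = "\<lambda>M. M $ i $ j"]) (simp add: transpose_def)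

lemma eq_minus_self_imp_zero:
  fixes a :: "'a::real_vector"
  assumes "a = - a"
  shows "a = 0"
proof -
  have "2 *\<^sub>R a = a - (- a)" by (simp add: scaleR_2)
  also have "\<dots> = 0" using assms by (rule right_minus_eq[THEN iffD2])
  finally show ?thesis by simp
qed

lemma sim_gen_symmetry:
  fixes A :: "real^'n^'n::finite"
  assumes A: "transpose A = - A"
  shows "smooth (\<xi> (sim_gen A s d e))" "smooth (\<eta> (sim_gen A s d e))" "NS_symmetry (sim_gen A s d e)"
proof -
  let ?X = "sim_gen A s d e"
  show sm: "smooth (\<xi> ?X)" "smooth (\<eta> ?X)"
    using smooth_affine[OF linear_sim_gen(1) \<xi>_sim_gen] smooth_affine[OF linear_sim_gen(2) \<eta>_sim_gen] by blast+
  have D\<xi>: "D1 (\<xi> ?X) z h = A *v fst h + s *\<^sub>R fst h" for z h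
    by (rule D1_eqI[OF has_derivative_affine[OF linear_sim_gen(1) \<xi>_sim_gen]])
  have D\<eta>: "D1 (\<eta> ?X) z h = (A *v fst (snd h) - s *\<^sub>R fst (snd h), - 2 * s * snd (snd h))" for z h
    by (rule D1_eqI[OF has_derivative_affine[OF linear_sim_gen(2) \<eta>_sim_gen]])
  have D2: "D2 (\<xi> ?X) z h h' = 0" "D2 (\<eta> ?X) z h h' = 0" for z h h'
    unfolding D2_def D\<xi> D\<eta> by (rule D1_eqI, rule has_derivative_const)+
  note sk = skew_nth[OF A]
  have A_axis: "(A *v axis i 1) $ k = A $ k $ i" for i k
    by (simp add: matrix_vector_mult_basis column_def)
  have ext_momentum0: "ext_momentum ?X x u p v1 v2 = 0"
    if jet: "\<And>i j. v2 $ i $ j = v2 $ j $ i"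
    and F: "(\<Sum>i\<in>UNIV. fst (v2 $ i $ i)) = (\<chi> i. snd (v1 $ i)) + (\<Sum>i\<in>UNIV. u $ i *\<^sub>R fst (v1 $ i))"
    for x u p v1 and v2 :: "(('n vp, 'n) vec, 'n) vec"
  proof -
    define F where "F = (\<Sum>i\<in>UNIV. fst (v2 $ i $ i))"
    define q where "q = (\<chi> i. snd (v1 $ i))"
    define S where "S = (\<Sum>i\<in>UNIV. u $ i *\<^sub>R fst (v1 $ i))"
    define W where "W = (\<Sum>k\<in>UNIV. (A *v u) $ k *\<^sub>R fst (v1 $ k))"
    have FqS: "F = q + S" using F by (simp add: F_def q_def S_def)
    have axis_sum: "(\<Sum>k\<in>UNIV. (axis i (1::real) $ k) *\<^sub>R w k) = w i" for i and w :: "'n \<Rightarrow> real^'n"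
    proof -
      have "(axis i (1::real) $ k) *\<^sub>R w k = (if k = i then w i else 0)" for k by (simp add: axis_nth_if)
      then show ?thesis by simp
    qed
    \<comment> \<open>A skew matrix is orthogonal to the symmetric Hessian.\<close>
    have "(\<Sum>i\<in>UNIV. \<Sum>k\<in>UNIV. A $ k $ i *\<^sub>R fst (v2 $ k $ i)) = 0" (is "?T = 0")
    proof -
      have "?T = (\<Sum>i\<in>UNIV. \<Sum>k\<in>UNIV. A $ i $ k *\<^sub>R fst (v2 $ i $ k))" by (rule sum.swap)
      also have "\<dots> = (\<Sum>i\<in>UNIV. \<Sum>k\<in>UNIV. - (A $ k $ i *\<^sub>R fst (v2 $ k $ i)))"
      proof (intro sum.cong refl)
        fix i k show "A $ i $ k *\<^sub>R fst (v2 $ i $ k) = - (A $ k $ i *\<^sub>R fst (v2 $ k $ i))"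
          using sk[of i k] jet[of i k] by simp
      qed
      also have "\<dots> = - ?T" by (simp add: sum_negf)
      finally have "?T = - ?T" .
      then show ?thesis by (rule eq_minus_self_imp_zero)
    qed
    then have 1: "(\<Sum>i\<in>UNIV. \<Sum>k\<in>UNIV. (A *v axis i 1 + s *\<^sub>R axis i 1) $ k *\<^sub>R fst (v2 $ k $ i)) = s *\<^sub>R F"
      using axis_sum[of _ "\<lambda>k. fst (v2 $ k $ _)"]
      by (simp add: A_axis scaleR_add_left sum.distrib F_def flip: scaleR_scaleR scaleR_sum_right)
    have 2: "(\<chi> j. - 2 * s * snd (v1 $ j) - (\<Sum>k\<in>UNIV. (A *v axis j 1 + s *\<^sub>R axis j 1) $ k * snd (v1 $ k)))
      = A *v q - (3 * s) *\<^sub>R q"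
    proof -
      have a: "(\<Sum>k\<in>UNIV. A $ k $ j * snd (v1 $ k)) = - (A *v q) $ j" for j
        unfolding matrix_vector_mult_def q_def by (simp add: sk[of _ j] flip: sum_negf)
      have b: "(\<Sum>k\<in>UNIV. s * axis j 1 $ k * snd (v1 $ k)) = s * snd (v1 $ j)" for j
      proof -
        have "s * axis j 1 $ k * snd (v1 $ k) = (if k = j then s * snd (v1 $ j) else 0)" for k
          by (simp add: axis_nth_if)
        then show ?thesis by simp
      qed
      have "- 2 * s * snd (v1 $ j) - (\<Sum>k\<in>UNIV. (A *v axis j 1 + s *\<^sub>R axis j 1) $ k * snd (v1 $ k))
        = (A *v q) $ j - 3 * s * q $ j" for j
        using a[of j] b[of j] by (simp add: A_axis distrib_right sum.distrib) (simp add: q_def)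
      then show ?thesis by (simp add: vec_eq_iff)
    qed
    have 3: "(\<Sum>i\<in>UNIV. u $ i *\<^sub>R (\<Sum>k\<in>UNIV. (A *v axis i 1 + s *\<^sub>R axis i 1) $ k *\<^sub>R fst (v1 $ k))) = W + s *\<^sub>R S"
    proof -
      have "(\<Sum>k\<in>UNIV. (A *v axis i 1 + s *\<^sub>R axis i 1) $ k *\<^sub>R fst (v1 $ k))
         = (\<Sum>k\<in>UNIV. A $ k $ i *\<^sub>R fst (v1 $ k)) + s *\<^sub>R fst (v1 $ i)" for i
        using axis_sum[of i "\<lambda>k. fst (v1 $ k)"]
        by (simp add: A_axis scaleR_add_left sum.distrib flip: scaleR_scaleR scaleR_sum_right)
      moreover have "(\<Sum>i\<in>UNIV. u $ i *\<^sub>R (\<Sum>k\<in>UNIV. A $ k $ i *\<^sub>R fst (v1 $ k))) = W"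
        unfolding W_def matrix_vector_mult_def scaleR_sum_right
        by (subst sum.swap) (simp add: scaleR_sum_left mult.commute)
      ultimately show ?thesis
        by (simp add: scaleR_add_right sum.distrib S_def scaleR_sum_right mult.commute)
    qed
    have lin: "linear ((*v) A)" by simp
    have 4: "(\<Sum>i\<in>UNIV. u $ i *\<^sub>R (A *v fst (v1 $ i))) = A *v S"
      by (simp add: S_def linear_sum[OF lin] matrix_vector_mult_scaleR)
    have 5: "(\<Sum>i\<in>UNIV. A *v fst (v2 $ i $ i)) = A *v F"
      by (simp add: F_def linear_sum[OF lin])
    have 6: "(\<Sum>i\<in>UNIV. (A *v u - s *\<^sub>R u) $ i *\<^sub>R fst (v1 $ i)) = W - s *\<^sub>R S"
      by (simp add: W_def S_def scaleR_diff_left sum_subtractf scaleR_sum_right)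
    have \<eta>_val: "fst (\<eta> ?X (x, u, p)) = A *v u - s *\<^sub>R u" by (simp add: \<eta>_sim_gen)
    have "ext_momentum ?X x u p v1 v2 =
      (\<Sum>i\<in>UNIV. A *v fst (v2 $ i $ i)) - s *\<^sub>R F
      - 2 *\<^sub>R (\<Sum>i\<in>UNIV. \<Sum>k\<in>UNIV. (A *v axis i 1 + s *\<^sub>R axis i 1) $ k *\<^sub>R fst (v2 $ k $ i))
      - (\<chi> j. - 2 * s * snd (v1 $ j) - (\<Sum>k\<in>UNIV. (A *v axis j 1 + s *\<^sub>R axis j 1) $ k * snd (v1 $ k)))
      - ((\<Sum>i\<in>UNIV. u $ i *\<^sub>R (A *v fst (v1 $ i))) - s *\<^sub>R S
         - (\<Sum>i\<in>UNIV. u $ i *\<^sub>R (\<Sum>k\<in>UNIV. (A *v axis i 1 + s *\<^sub>R axis i 1) $ k *\<^sub>R fst (v1 $ k)))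
         + (\<Sum>i\<in>UNIV. (A *v u - s *\<^sub>R u) $ i *\<^sub>R fst (v1 $ i)))"
      unfolding ext_momentum_def Let_def D2 D\<xi> D\<eta> fst_conv snd_conv \<eta>_val
      by (simp add: sum.distrib sum_subtractf scaleR_diff_right F_def S_def
          scaleR_sum_right[of s] scaleR_sum_right[of 2] matrix_vector_mult_0_right mult.commute)
    also have "\<dots> = 0"
      unfolding 1 2 3 4 5 6 FqS
      by (simp add: vec_eq_iff matrix_vector_right_distrib algebra_simps)
    finally show ?thesis .
  qed
  have ext_divergence0: "ext_divergence ?X x u p v1 = 0" if t: "(\<Sum>i\<in>UNIV. fst (v1 $ i) $ i) = 0" for x u p v1
  proof -
    have a: "(\<Sum>i\<in>UNIV. (A *v fst (v1 $ i)) $ i) = (\<Sum>i\<in>UNIV. \<Sum>k\<in>UNIV. A $ k $ i * fst (v1 $ k) $ i)"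
      unfolding matrix_vector_mult_def by (simp, rule sum.swap)
    have b: "(\<Sum>k\<in>UNIV. s * axis i 1 $ k * fst (v1 $ k) $ i) = s * fst (v1 $ i) $ i" for i
    proof -
      have "s * axis i 1 $ k * fst (v1 $ k) $ i = (if k = i then s * fst (v1 $ i) $ i else 0)" for k
        by (simp add: axis_nth_if)
      then show ?thesis by simp
    qed
    have "ext_divergence ?X x u p v1 = (\<Sum>i\<in>UNIV. (A *v fst (v1 $ i)) $ i)
      - (\<Sum>i\<in>UNIV. \<Sum>k\<in>UNIV. A $ k $ i * fst (v1 $ k) $ i) - 2 * s * (\<Sum>i\<in>UNIV. fst (v1 $ i) $ i)"
      unfolding ext_divergence_def Let_def D\<xi> D\<eta> fst_conv snd_conv
      by (simp add: A_axis distrib_right sum.distrib b sum_subtractf flip: sum_distrib_left)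
    then show ?thesis by (simp add: a t)
  qed
  show "NS_symmetry ?X"
    unfolding NS_symmetry_iff[OF sm[THEN smooth_imp_twice_diff]]
    using ext_momentum0 ext_divergence0 by blast
qed

lemma sim_gen_add: "sim_gen A s d e + sim_gen A' s' d' e' = sim_gen (A + A') (s + s') (d + d') (e + e')"
  by (auto simp: sim_gen_def fun_eq_iff matrix_vector_mult_add_rdistrib algebra_simps)

lemma sim_gen_scale: "vf_scale r (sim_gen A s d e) = sim_gen (r *\<^sub>R A) (r * s) (r *\<^sub>R d) (r * e)"
  by (auto simp: sim_gen_def vf_scale_def fun_eq_iff algebra_simps simp flip: scaleR_matrix_vector_assoc)

lemma transpose_add: "transpose (A + B) = transpose A + transpose B" for A B :: "real^'n^'m"
  by (simp add: transpose_def vec_eq_iff)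

lemma rotation_gen_eq: "rotation_gen A = sim_gen A 0 0 0"
  by (auto simp: rotation_gen_def sim_gen_def)

lemma span_generators:
  "vf.span ({translation_gen \<delta> |\<delta>. \<delta> \<noteq> 0} \<union> rotation_gen ` so \<union> {scaling_gen} \<union> {pressure_gen})
     = {sim_gen A s d e | A s (d :: real^'n::finite) e. transpose A = - A}" (is "vf.span ?G = ?V")
proof
  have sub: "vf.subspace ?V"
  proof (rule vf.subspaceI)
    have "(0 :: 'n vfield) = sim_gen 0 0 0 0" by (auto simp: sim_gen_def fun_eq_iff zero_prod_def)
    moreover have "transpose 0 = - (0 :: real^'n^'n)" by (simp add: transpose_def vec_eq_iff)
    ultimately show "0 \<in> ?V" by blast
    show "X + Y \<in> ?V" if "X \<in> ?V" "Y \<in> ?V" for X Y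
      using that by (force simp: sim_gen_add transpose_add)
    show "vf_scale r X \<in> ?V" if "X \<in> ?V" for r X
      using that by (force simp: sim_gen_scale transpose_scalar)
  qed
  have t0: "transpose 0 = - (0 :: real^'n^'n)" by (simp add: transpose_def vec_eq_iff)
  have "translation_gen \<delta> = sim_gen 0 0 (\<delta> /\<^sub>R norm \<delta>) 0" for \<delta> :: "real^'n"
    by (auto simp: translation_gen_def sim_gen_def)
  moreover have "(scaling_gen :: 'n vfield) = sim_gen 0 1 0 0"
    by (auto simp: scaling_gen_def sim_gen_def)
  moreover have "(pressure_gen :: 'n vfield) = sim_gen 0 0 0 1"
    by (auto simp: pressure_gen_def sim_gen_def)
  ultimately have "?G \<subseteq> ?V" using t0 unfolding rotation_gen_eq so_def by blast
  then show "vf.span ?G \<subseteq> ?V" by (rule vf.span_minimal[OF _ sub])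
  show "?V \<subseteq> vf.span ?G"
  proof
    fix X assume "X \<in> ?V"
    then obtain A s d e where X: "X = sim_gen A s d e" and A: "transpose A = - A" by blast
    have "X = (\<lambda>(x, u, p). (d, 0, 0)) + rotation_gen A + vf_scale s scaling_gen + vf_scale e pressure_gen"
      by (auto simp: X fun_eq_iff sim_gen_def rotation_gen_def vf_scale_def scaling_gen_def pressure_gen_def)
    moreover have "(\<lambda>(x, u, p). (d, 0, 0)) \<in> vf.span ?G"
    proof (cases "d = 0")
      case True
      then have "(\<lambda>(x, u, p). (d, 0, 0)) = (0 :: 'n vfield)" by (auto simp: fun_eq_iff zero_prod_def)
      then show ?thesis by (simp add: vf.span_zero)
    next
      case False
      then have "(\<lambda>(x, u, p). (d, 0, 0)) = vf_scale (norm d) (translation_gen d)"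
        by (auto simp: vf_scale_def translation_gen_def fun_eq_iff)
      moreover have "translation_gen d \<in> vf.span ?G"
        by (rule vf.span_base) (use False in blast)
      ultimately show ?thesis by (simp add: vf.span_scale)
    qed
    moreover have "rotation_gen A \<in> vf.span ?G"
      using A by (auto intro!: vf.span_base simp: so_def)
    moreover have "scaling_gen \<in> vf.span ?G" "pressure_gen \<in> vf.span ?G"
      by (rule vf.span_base, blast)+
    ultimately show "X \<in> vf.span ?G"
      by (simp only: vf.span_add vf.span_scale)
  qed
qed

lemma symmetries_eq:
  assumes "CARD('n::finite) \<ge> 2"
  shows "{X :: 'n vfield. smooth (\<xi> X) \<and> smooth (\<eta> X) \<and> NS_symmetry X}
    = {sim_gen A s d e | A s (d :: real^'n) e. transpose A = - A}"
proof
  show "{sim_gen A s d e | A s (d :: real^'n) e. transpose A = - A}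
    \<subseteq> {X :: 'n vfield. smooth (\<xi> X) \<and> smooth (\<eta> X) \<and> NS_symmetry X}"
    using sim_gen_symmetry by blast
  obtain a b :: 'n where "a \<noteq> b"
    using assms card_2_iff' card_le_Suc0_iff_eq[of "UNIV :: 'n set"] by auto
  show "{X :: 'n vfield. smooth (\<xi> X) \<and> smooth (\<eta> X) \<and> NS_symmetry X}
    \<subseteq> {sim_gen A s d e | A s (d :: real^'n) e. transpose A = - A}"
  proof safe
    fix X :: "'n vfield"
    assume X: "smooth (\<xi> X)" "smooth (\<eta> X)" "NS_symmetry X"
    interpret NS_sym X a b
      by unfold_locales (use X smooth_imp_twice_diff \<open>a \<noteq> b\<close> in blast)+
    obtain A s d e where A: "transpose A = - A"
      and "\<And>x u p. X (x, (u, p)) = (A *v x + s *\<^sub>R x + d, A *v u - s *\<^sub>R u, - 2 * s * p + e)"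
      by (rule symmetry_form) blast
    then have "X = sim_gen A s d e" by (auto simp: sim_gen_def fun_eq_iff)
    with A show "\<exists>A s d e. X = sim_gen A s d e \<and> transpose A = - A" by blast
  qed
qed

section \<open>The one-parameter groups\<close>

text \<open>A transformation of fields that reads the field at \<open>r x\<close> and moves the point of its graph found
  there by \<open>g\<close>.  In all examples \<open>g\<close> acts on \<open>x\<close> by the inverse of \<open>r\<close>, which is why most
  generators come with the reversed orientation of the parameter.\<close>

lemma inducesI:
  assumes g: "g \<circ> h = id" "h \<circ> g = id" and r: "surj r"
    and T: "\<And>f x. (x, T f x) = g (r x, f (r x))"
  shows "induces g T"
  unfolding induces_def
proof (intro conjI allI)
  show "bij g" using g by (rule o_bij[rotated])
  fix f
  have "range (\<lambda>x. (x, T f x)) = (\<lambda>y. g (y, f y)) ` range r" by (simp add: T image_image)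
  then show "range (\<lambda>x. (x, T f x)) = g ` range (\<lambda>x. (x, f x))"
    by (simp add: r image_image)
qed

lemma generates_translation:
  "generates (translation_gen \<delta>) (\<lambda>t. translate (t *\<^sub>R (\<delta> /\<^sub>R norm \<delta>)))" for \<delta> :: "real^'n::finite"
  unfolding generates_def
proof (intro conjI allI exI[of _ "\<lambda>t (x, v). (x - t *\<^sub>R (\<delta> /\<^sub>R norm \<delta>), v)"] disjI2)
  define d where "d = \<delta> /\<^sub>R norm \<delta>"
  fix s t
  show "translate ((s + t) *\<^sub>R (\<delta> /\<^sub>R norm \<delta>)) =
    translate (s *\<^sub>R (\<delta> /\<^sub>R norm \<delta>)) \<circ> (translate (t *\<^sub>R (\<delta> /\<^sub>R norm \<delta>)) :: 'n vpfield \<Rightarrow> _)"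
    unfolding d_def[symmetric] by (simp add: translate_def fun_eq_iff scaleR_add_left add.assoc)
  show "induces (\<lambda>(x, v). (x - t *\<^sub>R (\<delta> /\<^sub>R norm \<delta>), v)) (translate (t *\<^sub>R (\<delta> /\<^sub>R norm \<delta>)))"
    unfolding d_def[symmetric]
  proof (rule inducesI[where h = "\<lambda>(x, v). (x + t *\<^sub>R d, v)" and r = "\<lambda>x. x + t *\<^sub>R d"])
    show "surj (\<lambda>x. x + t *\<^sub>R d)" by (rule surjI[of _ "\<lambda>x. x - t *\<^sub>R d"]) simp
  qed (auto simp: fun_eq_iff translate_def)
  fix z :: "'n point"
  obtain x v where z: "z = (x, v)" by (rule prod.exhaust)
  have "((\<lambda>t. (x - t *\<^sub>R d, v)) has_vector_derivative (0 - 1 *\<^sub>R d, 0)) (at 0)"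
    by (auto intro!: derivative_eq_intros)
  then show "((\<lambda>t. case z of (x, v) \<Rightarrow> (x - t *\<^sub>R (\<delta> /\<^sub>R norm \<delta>), v))
      has_vector_derivative - translation_gen \<delta> z) (at 0)"
    unfolding d_def[symmetric] by (cases v) (simp add: z translation_gen_def d_def zero_prod_def)
qed

lemma generates_scaling: "generates (scaling_gen :: 'n::finite vfield) scale_field"
  unfolding generates_def
proof (intro conjI allI exI[of _ "\<lambda>t (x, u, p). (exp (- t) *\<^sub>R x, exp t *\<^sub>R u, exp (2 * t) * p)"] disjI2)
  fix s t :: real
  show "scale_field (s + t) = scale_field s \<circ> (scale_field t :: 'n vpfield \<Rightarrow> _)"
    by (simp add: scale_field_def fun_eq_iff exp_add distrib_left mult_ac)
  have e: "exp (- r) * exp r = 1" "exp r * exp (- r) = 1" for r :: real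
    by (simp_all flip: exp_add)
  have e': "exp (- r) * (exp r * q) = q" "exp r * (exp (- r) * q) = q" for r q :: real
    by (simp_all add: e flip: mult.assoc)
  show "induces (\<lambda>(x :: real^'n, u, p). (exp (- t) *\<^sub>R x, exp t *\<^sub>R u, exp (2 * t) * p)) (scale_field t)"
  proof (rule inducesI[where h = "\<lambda>(x, u, p). (exp t *\<^sub>R x, exp (- t) *\<^sub>R u, exp (- (2 * t)) * p)" and r = "\<lambda>x. exp t *\<^sub>R x"])
    show "surj (\<lambda>x :: real^'n. exp t *\<^sub>R x)"
      by (rule surjI[of _ "\<lambda>x. exp (- t) *\<^sub>R x"]) (simp add: e)
    show "(x, scale_field t f x) = (case (exp t *\<^sub>R x, f (exp t *\<^sub>R x)) of
        (x, u, p) \<Rightarrow> (exp (- t) *\<^sub>R x, exp t *\<^sub>R u, exp (2 * t) * p))" for f and x :: "real^'n"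
      by (simp add: scale_field_def split_beta e)
  qed (auto simp: fun_eq_iff e e')
  fix z :: "'n point"
  obtain x u p where z: "z = (x, u, p)" by (metis prod.collapse)
  have "((\<lambda>t. exp (- t) *\<^sub>R x) has_vector_derivative - x) (at 0)"
    by (auto intro!: derivative_eq_intros)
  moreover have "((\<lambda>t. exp t *\<^sub>R u) has_vector_derivative u) (at 0)"
    by (auto intro!: derivative_eq_intros)
  moreover have "((\<lambda>t. exp (2 * t) * p) has_vector_derivative 2 * p) (at 0)"
    by (auto intro!: derivative_eq_intros simp flip: has_real_derivative_iff_has_vector_derivative)
  ultimately show "((\<lambda>t. case z of (x, u, p) \<Rightarrow> (exp (- t) *\<^sub>R x, exp t *\<^sub>R u, exp (2 * t) * p))
      has_vector_derivative - scaling_gen z) (at 0)"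
    unfolding z prod.case scaling_gen_def by (simp add: has_vector_derivative_Pair)
qed

lemma generates_pressure: "generates (pressure_gen :: 'n::finite vfield) shift_pressure"
  unfolding generates_def
proof (intro conjI allI exI[of _ "\<lambda>t (x, u, p). (x, u, p + t)"] disjI1)
  fix s t :: real
  show "shift_pressure (s + t) = shift_pressure s \<circ> (shift_pressure t :: 'n vpfield \<Rightarrow> _)"
    by (simp add: shift_pressure_def fun_eq_iff)
  show "induces (\<lambda>(x :: real^'n, u, p). (x, u, p + t)) (shift_pressure t)"
    by (rule inducesI[where h = "\<lambda>(x, u, p). (x, u, p - t)" and r = id])
      (auto simp: fun_eq_iff shift_pressure_def split_beta)
  fix z :: "'n point"
  obtain x u p where z: "z = (x, u, p)" by (metis prod.collapse)
  have "((\<lambda>t. (x, u, p + t)) has_vector_derivative (0, 0, 0 + 1)) (at 0)"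
    by (intro derivative_intros)
  then show "((\<lambda>t. case z of (x, u, p) \<Rightarrow> (x, u, p + t)) has_vector_derivative pressure_gen z) (at 0)"
    by (simp add: z pressure_gen_def)
qed

section \<open>Rotations\<close>

lemma matrix_inv_orthogonal:
  fixes R :: "real^'n::finite^'n"
  assumes "orthogonal_matrix R"
  shows "matrix_inv R = transpose R"
proof -
  have R: "R ** transpose R = mat 1" "transpose R ** R = mat 1"
    using assms by (auto simp: orthogonal_matrix_def)
  then have "R ** matrix_inv R = mat 1 \<and> matrix_inv R ** R = mat 1"
    unfolding matrix_inv_def by (intro someI[of "\<lambda>S. R ** S = mat 1 \<and> S ** R = mat 1"]) blast
  then show ?thesis using R by (metis matrix_mul_assoc matrix_mul_lid matrix_mul_rid)
qed

lemma induces_rotate: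
  fixes R :: "real^'n::finite^'n"
  assumes R: "orthogonal_matrix R"
  shows "induces (\<lambda>(x, u, p). (transpose R *v x, transpose R *v u, p)) (rotate_field R)"
proof -
  have R1: "R *v (transpose R *v x) = x" "transpose R *v (R *v x) = x" for x
    using R unfolding orthogonal_matrix_def
    by (simp_all only: matrix_vector_mul_assoc matrix_vector_mul_lid)
  show ?thesis
  proof (rule inducesI[where h = "\<lambda>(x, u, p). (R *v x, R *v u, p)" and r = "\<lambda>x. R *v x"])
    show "surj (\<lambda>x. R *v x)" by (rule surjI[of _ "\<lambda>x. transpose R *v x"]) (rule R1)
    show "(x, rotate_field R f x) = (case (R *v x, f (R *v x)) of
       (x, u, p) \<Rightarrow> (transpose R *v x, transpose R *v u, p))" for f x
      unfolding rotate_field_def matrix_inv_orthogonal[OF R] split_beta fst_conv snd_conv R1 ..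
  qed (auto simp only: fun_eq_iff o_def id_def R1 split_beta prod.collapse fst_conv snd_conv)
qed

text \<open>Two graphs that meet in one point only show that the point transformation is determined by
  the transformation of fields.\<close>

lemma induces_unique:
  fixes g g' :: "'n::finite point \<Rightarrow> 'n point"
  assumes g: "induces g T" and g': "induces g' T"
  shows "g = g'"
proof
  fix z :: "'n point"
  obtain x v where z: "z = (x, v)" by (rule prod.exhaust)
  let ?G = "\<lambda>f :: 'n vpfield. range (\<lambda>x. (x, f x))"
  define f1 :: "'n vpfield" where "f1 = (\<lambda>_. v)"
  define f2 :: "'n vpfield" where "f2 = (\<lambda>y. if y = x then v else v + (0, 1))"
  have one: "?G f1 \<inter> ?G f2 = {z}"
    by (auto simp: f1_def f2_def z split: if_splits)
  have *: "h ` {z} = (\<Inter>f\<in>{f1, f2}. range (\<lambda>x. (x, T f x)))" if "induces h T" for h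
  proof -
    have "inj h" using that by (simp add: induces_def bij_def)
    then have "h ` {z} = h ` ?G f1 \<inter> h ` ?G f2"
      unfolding one[symmetric] by (rule image_Int)
    then show ?thesis using that by (simp add: induces_def)
  qed
  have "g ` {z} = g' ` {z}" unfolding *[OF g] *[OF g'] ..
  then show "g z = g' z" by simp
qed

text \<open>In dimension two and three a skew matrix satisfies \<open>A\<^sup>3 = - \<theta>\<^sup>2 A\<close>; this is the source of
  Rodrigues' formula for its exponential.\<close>

lemma skew_cube:
  fixes A :: "real^'n::finite^'n"
  assumes n: "CARD('n) = 2 \<or> CARD('n) = 3" and A: "transpose A = - A"
  obtains \<theta> where "\<And>x. A *v (A *v (A *v x)) = - (\<theta>\<^sup>2) *\<^sub>R (A *v x)" "\<theta> = 0 \<Longrightarrow> A = 0"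
proof -
  define \<theta> where "\<theta> = sqrt ((\<Sum>i\<in>UNIV. \<Sum>j\<in>UNIV. (A $ i $ j)\<^sup>2) / 2)"
  have t2: "\<theta>\<^sup>2 = (\<Sum>i\<in>UNIV. \<Sum>j\<in>UNIV. (A $ i $ j)\<^sup>2) / 2"
    unfolding \<theta>_def by (intro real_sqrt_pow2 divide_nonneg_pos sum_nonneg) auto
  note sk = skew_nth[OF A]
  have diag: "A $ i $ i = 0" for i using sk[of i i] by simp
  have "A = 0" if "\<theta> = 0"
  proof -
    have "(\<Sum>i\<in>UNIV. \<Sum>j\<in>UNIV. (A $ i $ j)\<^sup>2) = 0" using t2 that by simp
    then have "(A $ i $ j)\<^sup>2 = 0" for i j
      by (simp add: sum_nonneg_eq_0_iff sum_nonneg)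
    then show ?thesis by (simp add: vec_eq_iff)
  qed
  moreover have "A *v (A *v (A *v x)) = - (\<theta>\<^sup>2) *\<^sub>R (A *v x)" for x
    using n
  proof
    assume "CARD('n) = 2"
    then obtain a b :: 'n where U: "UNIV = {a, b}" and ab: "a \<noteq> b" unfolding card_2_iff by blast
    have all: "(\<forall>i. P i) \<longleftrightarrow> P a \<and> P b" for P using U by (metis UNIV_I insertE singletonD)
    have t2': "\<theta>\<^sup>2 = (A $ b $ a)\<^sup>2"
      unfolding t2 U using ab by (simp add: diag sk[of a b])
    show ?thesis
      unfolding vec_eq_iff all t2' using ab
      by (simp add: matrix_vector_mult_def U diag sk[of a b] power2_eq_square algebra_simps)
  next
    assume "CARD('n) = 3"
    then obtain a b c :: 'n where U: "UNIV = {a, b, c}" and ab: "a \<noteq> b" "b \<noteq> c" "a \<noteq> c"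
      unfolding card_3_iff by blast
    have all: "(\<forall>i. P i) \<longleftrightarrow> P a \<and> P b \<and> P c" for P using U by (metis UNIV_I insertE singletonD)
    have t2': "\<theta>\<^sup>2 = (A $ b $ a)\<^sup>2 + (A $ c $ a)\<^sup>2 + (A $ c $ b)\<^sup>2"
      unfolding t2 U using ab by (simp add: diag sk[of a b] sk[of a c] sk[of b c])
    show ?thesis
      unfolding vec_eq_iff all t2' using ab
      by (simp add: matrix_vector_mult_def U diag sk[of a b] sk[of a c] sk[of b c] power2_eq_square algebra_simps)
  qed
  ultimately show ?thesis using that by blast
qed

lemma skew_one_parameter_group:
  fixes A :: "real^'n::finite^'n"
  assumes n: "CARD('n) = 2 \<or> CARD('n) = 3" and A: "transpose A = - A"
  obtains R :: "real \<Rightarrow> real^'n^'n" where "\<And>t. rotation_matrix (R t)" "\<And>s t. R (s + t) = R s ** R t"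
    "\<And>t. transpose (R t) = R (- t)" "\<And>x. ((\<lambda>t. R t *v x) has_vector_derivative A *v x) (at 0)"
proof -
  obtain \<theta> where cube: "\<And>x. A *v (A *v (A *v x)) = - (\<theta>\<^sup>2) *\<^sub>R (A *v x)" and A0: "\<theta> = 0 \<Longrightarrow> A = 0"
    by (rule skew_cube[OF n A]) blast
  \<comment> \<open>Rodrigues' formula.  If \<open>\<theta> = 0\<close> then \<open>A = 0\<close>, and the values of the divisions by zero are
    immaterial.\<close>
  define \<alpha> where "\<alpha> t = sin (\<theta> * t) / \<theta>" for t
  define \<beta> where "\<beta> t = (1 - cos (\<theta> * t)) / \<theta>\<^sup>2" for t
  define R where "R t = mat 1 + \<alpha> t *\<^sub>R A + \<beta> t *\<^sub>R (A ** A)" for t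
  have Rx: "R t *v x = x + \<alpha> t *\<^sub>R (A *v x) + \<beta> t *\<^sub>R (A *v (A *v x))" for t x
    by (simp add: R_def matrix_vector_mult_add_rdistrib matrix_vector_mul_assoc flip: scaleR_matrix_vector_assoc)
  have hom: "R (s + t) = R s ** R t" for s t
  proof (cases "\<theta> = 0")
    case True
    then show ?thesis by (simp add: R_def A0)
  next
    case False
    have 1: "\<alpha> (s + t) = \<alpha> s + \<alpha> t - \<theta>\<^sup>2 * (\<alpha> s * \<beta> t + \<beta> s * \<alpha> t)"
      using False by (simp add: \<alpha>_def \<beta>_def distrib_left sin_add field_simps power2_eq_square)
    have 2: "\<beta> (s + t) = \<beta> s + \<beta> t + \<alpha> s * \<alpha> t - \<theta>\<^sup>2 * (\<beta> s * \<beta> t)"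
      using False by (simp add: \<alpha>_def \<beta>_def distrib_left cos_add field_simps power2_eq_square)
    have "R (s + t) *v x = (R s ** R t) *v x" for x
      unfolding matrix_vector_mul_assoc[symmetric] Rx 1 2
      by (simp add: matrix_vector_right_distrib matrix_vector_mult_scaleR cube)
        (simp add: cube vec_eq_iff algebra_simps)
    then show ?thesis by (simp add: matrix_eq)
  qed
  have R0: "R 0 = mat 1" by (simp add: R_def \<alpha>_def \<beta>_def)
  have tr: "transpose (R t) = R (- t)" for t
  proof -
    have neg: "(- A) *v y = - (A *v y)" "A *v (- y) = - (A *v y)" for y
      by (simp_all add: matrix_vector_mult_def vec_eq_iff sum_negf)
    have "transpose (A ** A) = A ** A"
      by (simp add: matrix_transpose_mul A matrix_eq neg flip: matrix_vector_mul_assoc)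
    moreover have "\<alpha> (- t) = - \<alpha> t" "\<beta> (- t) = \<beta> t" by (simp_all add: \<alpha>_def \<beta>_def)
    ultimately show ?thesis by (simp add: R_def transpose_add transpose_scalar A)
  qed
  have orth: "orthogonal_matrix (R t)" for t
    unfolding orthogonal_matrix tr using hom[of "- t" t] R0 by simp
  \<comment> \<open>The determinant is \<open>\<plusminus> 1\<close> and a square, so that no continuity argument is needed.\<close>
  have "det (R t) = 1" for t
  proof -
    have "det (R t) = det (R (t / 2)) * det (R (t / 2))"
      using hom[of "t / 2" "t / 2"] by (simp add: det_mul)
    then show ?thesis using det_orthogonal_matrix[OF orth[of "t / 2"]] by auto
  qed
  then have rot: "rotation_matrix (R t)" for t by (simp add: rotation_matrix_def orth)
  have "((\<lambda>t. R t *v x) has_vector_derivative A *v x) (at 0)" for x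
  proof (cases "\<theta> = 0")
    case True
    then show ?thesis by (simp add: R_def A0)
  next
    case False
    have "(\<alpha> has_real_derivative 1) (at 0)" "(\<beta> has_real_derivative 0) (at 0)"
      unfolding \<alpha>_def[abs_def] \<beta>_def[abs_def] using False
      by (auto intro!: derivative_eq_intros)
    then have "((\<lambda>t. x + \<alpha> t *\<^sub>R (A *v x) + \<beta> t *\<^sub>R (A *v (A *v x)))
      has_vector_derivative 0 + (\<alpha> 0 *\<^sub>R 0 + 1 *\<^sub>R (A *v x)) + (\<beta> 0 *\<^sub>R 0 + 0 *\<^sub>R (A *v (A *v x)))) (at 0)"
      by (intro derivative_intros)
    then show ?thesis by (simp add: Rx)
  qed
  with rot hom tr show ?thesis using that by blast
qed

lemma generates_rotation:
  fixes A :: "real^'n::finite^'n" and R :: "real \<Rightarrow> real^'n^'n"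
  assumes rot: "\<And>t. rotation_matrix (R t)" and hom: "\<And>s t. R (s + t) = R s ** R t"
    and tr: "\<And>t. transpose (R t) = R (- t)"
    and der: "\<And>x. ((\<lambda>t. R t *v x) has_vector_derivative A *v x) (at 0)"
  shows "generates (rotation_gen A) (\<lambda>t. rotate_field (R t))"
  unfolding generates_def
proof (intro conjI allI exI[of _ "\<lambda>t (x, u, p). (transpose (R t) *v x, transpose (R t) *v u, p)"] disjI2)
  have orth: "orthogonal_matrix (R t)" for t using rot by (simp add: rotation_matrix_def)
  fix s t
  have R: "R (s + t) = R t ** R s" using hom[of t s] by (simp add: add.commute)
  have inv: "matrix_inv (R t ** R s) = matrix_inv (R s) ** matrix_inv (R t)"
    unfolding matrix_inv_orthogonal[OF orth] matrix_inv_orthogonal[OF orthogonal_matrix_mul[OF orth orth]]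
    by (rule matrix_transpose_mul)
  show "rotate_field (R (s + t)) = rotate_field (R s) \<circ> rotate_field (R t)"
    by (simp add: rotate_field_def fun_eq_iff inv R flip: matrix_vector_mul_assoc)
  show "induces (\<lambda>(x, u, p). (transpose (R t) *v x, transpose (R t) *v u, p)) (rotate_field (R t))"
    by (rule induces_rotate[OF orth])
  fix z :: "'n point"
  obtain x u p where z: "z = (x, u, p)" by (metis prod.collapse)
  have "(uminus has_vector_derivative (- 1 :: real)) (at 0)"
    by (auto intro!: derivative_eq_intros)
  then have "((\<lambda>t. R (- t) *v x) has_vector_derivative - (A *v x)) (at 0)" for x
    using vector_diff_chain_at[of uminus "- 1" 0 "\<lambda>t. R t *v x" "A *v x"] der[of x]
    by (simp add: o_def)
  then show "((\<lambda>t. case z of (x, u, p) \<Rightarrow> (transpose (R t) *v x, transpose (R t) *v u, p))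
      has_vector_derivative - rotation_gen A z) (at 0)"
    unfolding z prod.case rotation_gen_def tr by (auto intro!: derivative_eq_intros)
qed

text \<open>Conversely, a generator of a group of rotations is skew.  The existence of its derivative is
  part of \<open>generates\<close>, so that no continuity of \<open>R\<close> has to be assumed.  The sign \<open>\<epsilon>\<close> below is the
  orientation of the parameter.\<close>

lemma generator_of_rotations:
  fixes R :: "real \<Rightarrow> real^'n::finite^'n"
  assumes rot: "\<And>t. rotation_matrix (R t)" and hom: "\<And>s t. R (s + t) = R s ** R t"
    and gen: "generates X (\<lambda>t. rotate_field (R t))"
  shows "X \<in> rotation_gen ` so"
proof -
  have orth: "orthogonal_matrix (R t)" for t using rot by (simp add: rotation_matrix_def)
  define M where "M t = transpose (R t)" for t
  have MM: "transpose (M t) ** M t = mat 1" for t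
    using orth[of t] by (simp add: M_def orthogonal_matrix_def)
  have "R 0 = R 0 ** R 0" using hom[of 0 0] by simp
  then have "transpose (R 0) ** R 0 = (transpose (R 0) ** R 0) ** R 0"
    by (simp flip: matrix_mul_assoc)
  then have "R 0 = mat 1" using orth[of 0] by (simp add: orthogonal_matrix_def)
  then have M0: "M 0 = mat 1" by (simp add: M_def)
  obtain g where ind: "\<And>t. induces (g t) (rotate_field (R t))"
    and d: "(\<forall>z. ((\<lambda>t. g t z) has_vector_derivative X z) (at 0)) \<or>
       (\<forall>z. ((\<lambda>t. g t z) has_vector_derivative - X z) (at 0))"
    using gen unfolding generates_def by blast
  have g: "g t (x, u, p) = (M t *v x, M t *v u, p)" for t x u p
    unfolding induces_unique[OF ind induces_rotate[OF orth]] M_def by simp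
  obtain \<epsilon> :: real where \<epsilon>: "\<epsilon> * \<epsilon> = 1"
    and d: "\<And>z. ((\<lambda>t. g t z) has_vector_derivative \<epsilon> *\<^sub>R X z) (at 0)"
  proof (cases "\<forall>z. ((\<lambda>t. g t z) has_vector_derivative X z) (at 0)")
    case True
    then show ?thesis by (intro that[of 1]) (simp_all del: split_paired_All)
  next
    case False
    then have "\<forall>z. ((\<lambda>t. g t z) has_vector_derivative - X z) (at 0)" using d by blast
    then show ?thesis by (intro that[of "- 1"]) (simp_all del: split_paired_All)
  qed
  have d': "((\<lambda>t. (M t *v x, M t *v u, p)) has_vector_derivative \<epsilon> *\<^sub>R X (x, u, p)) (at 0)" for x u p
    using d[of "(x, u, p)"] by (simp add: g)
  define D where "D x = \<epsilon> *\<^sub>R fst (X (x, 0, 0))" for x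
  have D: "((\<lambda>t. M t *v x) has_vector_derivative D x) (at 0)" for x
    using bounded_linear.has_vector_derivative[OF bounded_linear_fst d'[of x 0 0]] by (simp add: D_def)
  have lin: "linear D"
  proof (rule linearI)
    fix x y and r :: real
    have "((\<lambda>t. M t *v (x + y)) has_vector_derivative D x + D y) (at 0)"
      unfolding matrix_vector_right_distrib by (intro derivative_intros D)
    then show "D (x + y) = D x + D y" using D vector_derivative_unique_at by blast
    have "((\<lambda>t. M t *v (r *\<^sub>R x)) has_vector_derivative r *\<^sub>R D x) (at 0)"
      unfolding matrix_vector_mult_scaleR
      by (rule bounded_linear.has_vector_derivative[OF bounded_linear_scaleR_right D])
    then show "D (r *\<^sub>R x) = r *\<^sub>R D x" using D vector_derivative_unique_at by blast
  qed
  define B where "B = matrix D"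
  have B: "B *v x = D x" for x using lin by (simp add: B_def matrix_works)
  have skew: "D x \<bullet> y + x \<bullet> D y = 0" for x y
  proof -
    have "((\<lambda>t. (M t *v x) \<bullet> (M t *v y)) has_vector_derivative (M 0 *v x) \<bullet> D y + D x \<bullet> (M 0 *v y)) (at 0)"
      using bounded_bilinear.has_vector_derivative[OF bounded_bilinear_inner D D] .
    moreover have "(M t *v x) \<bullet> (M t *v y) = x \<bullet> y" for t
    proof -
      have "(M t *v x) \<bullet> (M t *v y) = (transpose (M t) *v (M t *v x)) \<bullet> y"
        by (simp add: dot_lmul_matrix)
      then show ?thesis by (simp only: matrix_vector_mul_assoc MM matrix_vector_mul_lid)
    qed
    ultimately have "((\<lambda>t::real. x \<bullet> y) has_vector_derivative (x \<bullet> D y + D x \<bullet> y)) (at 0)"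
      by (simp add: M0)
    then show ?thesis using has_vector_derivative_const vector_derivative_unique_at by fastforce
  qed
  have "B $ j $ i = - B $ i $ j" for i j
    using skew[of "axis i 1" "axis j 1"]
    by (simp add: B_def matrix_def inner_axis inner_axis')
  then have "transpose B = - B" by (rule skewI)
  then have "\<epsilon> *\<^sub>R B \<in> so" by (simp add: so_def transpose_scalar)
  moreover have "X = rotation_gen (\<epsilon> *\<^sub>R B)"
  proof
    fix z :: "'n point"
    obtain x u p where z: "z = (x, u, p)" by (metis prod.collapse)
    have "((\<lambda>t. (M t *v x, M t *v u, p)) has_vector_derivative (D x, D u, 0)) (at 0)"
      by (intro derivative_intros D)
    with d'[of x u p] have e: "\<epsilon> *\<^sub>R X z = (B *v x, B *v u, 0)"
      unfolding z B by (rule vector_derivative_unique_at)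
    have "X z = \<epsilon> *\<^sub>R (\<epsilon> *\<^sub>R X z)" using \<epsilon> by simp
    then show "X z = rotation_gen (\<epsilon> *\<^sub>R B) z"
      unfolding e by (simp add: z rotation_gen_def scaleR_matrix_vector_assoc)
  qed
  ultimately show ?thesis by blast
qed

lemma rotation_generators:
  assumes n: "CARD('n::finite) = 2 \<or> CARD('n) = 3"
  shows "rotation_gen ` (so :: (real^'n^'n) set) = {X. \<exists>R :: real \<Rightarrow> real^'n^'n.
     (\<forall>t. rotation_matrix (R t)) \<and> (\<forall>s t. R (s + t) = R s ** R t) \<and> generates X (\<lambda>t. rotate_field (R t))}"
proof (intro equalityI subsetI)
  fix X :: "'n vfield" assume "X \<in> rotation_gen ` so"
  then obtain A :: "real^'n^'n" where A: "transpose A = - A" and X: "X = rotation_gen A" by (auto simp: so_def)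
  obtain R :: "real \<Rightarrow> real^'n^'n" where R: "\<And>t. rotation_matrix (R t)" "\<And>s t. R (s + t) = R s ** R t"
    "\<And>t. transpose (R t) = R (- t)" "\<And>x. ((\<lambda>t. R t *v x) has_vector_derivative A *v x) (at 0)"
    by (rule skew_one_parameter_group[OF n A]) blast
  from generates_rotation[OF R] R(1,2) show "X \<in> {X. \<exists>R :: real \<Rightarrow> real^'n^'n.
     (\<forall>t. rotation_matrix (R t)) \<and> (\<forall>s t. R (s + t) = R s ** R t) \<and> generates X (\<lambda>t. rotate_field (R t))}"
    unfolding X by blast
qed (auto intro: generator_of_rotations)

section \<open>The dimension of the space of rotations\<close>

text \<open>The elementary skew matrix that maps \<open>e\<^sub>a\<close> to \<open>e\<^sub>b\<close> and \<open>e\<^sub>b\<close> to \<open>- e\<^sub>a\<close>, for \<open>a \<noteq> b\<close>.\<close>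

definition elem_skew :: "'n::finite \<Rightarrow> 'n \<Rightarrow> real^'n^'n" where
  "elem_skew a b = (\<chi> i j. if i = a \<and> j = b then - 1 else if i = b \<and> j = a then 1 else 0)"

lemma elem_skew_so: "a \<noteq> b \<Longrightarrow> elem_skew a b \<in> so"
  unfolding so_def mem_Collect_eq by (rule skewI) (auto simp: elem_skew_def)

lemma rotation_gen_linear:
  "rotation_gen (A - B) = rotation_gen A - rotation_gen B"
  "rotation_gen (A + B) = rotation_gen A + rotation_gen B"
  "rotation_gen (r *\<^sub>R A) = vf_scale r (rotation_gen A)"
  by (auto simp: rotation_gen_def vf_scale_def fun_eq_iff matrix_vector_mult_diff_rdistrib
      matrix_vector_mult_add_rdistrib simp flip: scaleR_matrix_vector_assoc)

lemma rotation_gen_eq_0: "rotation_gen A = 0 \<longleftrightarrow> A = 0" for A :: "real^'n::finite^'n"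
proof
  assume "rotation_gen A = 0"
  then have "rotation_gen A (x, 0, 0) = 0" for x by simp
  then have "A *v x = 0 *v x" for x by (simp add: rotation_gen_def zero_prod_def)
  then show "A = 0" by (simp add: matrix_eq)
qed (auto simp: rotation_gen_def fun_eq_iff zero_prod_def)

lemma so_subspace: "vf.subspace (rotation_gen ` (so :: (real^'n::finite^'n) set))"
proof (rule vf.subspaceI)
  have "(0 :: real^'n^'n) \<in> so" by (simp add: so_def transpose_def vec_eq_iff)
  moreover have "0 = rotation_gen (0 :: real^'n^'n)" by (rule rotation_gen_eq_0[THEN iffD2, OF refl, symmetric])
  ultimately show "0 \<in> rotation_gen ` (so :: (real^'n^'n) set)" by (rule rev_image_eqI)
next
  fix X Y :: "'n vfield" and r
  assume "X \<in> rotation_gen ` so"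
  then obtain A where A: "A \<in> so" "X = rotation_gen A" by blast
  have "r *\<^sub>R A \<in> so" using A by (simp add: so_def transpose_scalar)
  then show "vf_scale r X \<in> rotation_gen ` so" using A by (auto simp flip: rotation_gen_linear)
  assume "Y \<in> rotation_gen ` so"
  then obtain B where B: "B \<in> so" "Y = rotation_gen B" by blast
  have "A + B \<in> so" using A B by (simp add: so_def transpose_add)
  then show "X + Y \<in> rotation_gen ` so" using A B by (auto simp flip: rotation_gen_linear)
qed

lemma span_rotation_gen_subset: "S \<subseteq> so \<Longrightarrow> vf.span (rotation_gen ` S) \<subseteq> rotation_gen ` so"
  by (intro vf.span_minimal so_subspace image_mono)

lemma rotation_basis_2:
  assumes U: "UNIV = {a, b :: 'n::finite}" and ab: "a \<noteq> b"
  shows "rotation_gen ` (so :: (real^'n^'n) set) = vf.span {rotation_gen (elem_skew a b)}"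
    and "vf.independent {rotation_gen (elem_skew a b)}"
proof
  have all: "(\<forall>i. P i) \<longleftrightarrow> P a \<and> P b" for P using U by (metis UNIV_I insertE singletonD)
  show "vf.span {rotation_gen (elem_skew a b)} \<subseteq> rotation_gen ` so"
    using span_rotation_gen_subset[of "{elem_skew a b}"] elem_skew_so[OF ab] by simp
  show "rotation_gen ` so \<subseteq> vf.span {rotation_gen (elem_skew a b)}"
  proof
    fix X :: "'n vfield" assume "X \<in> rotation_gen ` so"
    then obtain A :: "real^'n^'n" where X: "X = rotation_gen A" and "transpose A = - A" by (auto simp: so_def)
    note sk = skew_nth[OF this(2)]
    have "A $ i $ i = 0" for i using sk[of i i] by simp
    then have "A = A $ b $ a *\<^sub>R elem_skew a b"
      using ab sk[of a b] by (simp add: vec_eq_iff all elem_skew_def)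
    then show "X \<in> vf.span {rotation_gen (elem_skew a b)}"
      unfolding X vf.span_singleton by (metis rotation_gen_linear(3) rangeI)
  qed
  have "elem_skew a b $ b $ a \<noteq> 0" using ab by (simp add: elem_skew_def)
  then have "elem_skew a b \<noteq> 0" by auto
  then show "vf.independent {rotation_gen (elem_skew a b)}"
    by (simp add: rotation_gen_eq_0)
qed

lemma rotation_basis_3:
  assumes U: "UNIV = {a, b, c :: 'n::finite}" and ne: "a \<noteq> b" "b \<noteq> c" "a \<noteq> c"
  defines "B \<equiv> {rotation_gen (elem_skew a b), rotation_gen (elem_skew a c), rotation_gen (elem_skew b c)}"
  shows "rotation_gen ` (so :: (real^'n^'n) set) = vf.span B" and "vf.independent B" and "card B = 3"
proof
  have all: "(\<forall>i. P i) \<longleftrightarrow> P a \<and> P b \<and> P c" for P using U by (metis UNIV_I insertE singletonD)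
  show "vf.span B \<subseteq> rotation_gen ` so"
    using span_rotation_gen_subset[of "{elem_skew a b, elem_skew a c, elem_skew b c}"]
      elem_skew_so[OF ne(1)] elem_skew_so[OF ne(2)] elem_skew_so[OF ne(3)] by (simp add: B_def)
  show "rotation_gen ` so \<subseteq> vf.span B"
  proof
    fix X :: "'n vfield" assume "X \<in> rotation_gen ` so"
    then obtain A :: "real^'n^'n" where X: "X = rotation_gen A" and "transpose A = - A" by (auto simp: so_def)
    note sk = skew_nth[OF this(2)]
    have "A $ i $ i = 0" for i using sk[of i i] by simp
    then have "A = A $ b $ a *\<^sub>R elem_skew a b + A $ c $ a *\<^sub>R elem_skew a c + A $ c $ b *\<^sub>R elem_skew b c"
      using ne sk[of a b] sk[of a c] sk[of b c] by (simp add: vec_eq_iff all elem_skew_def)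
    then have "X = vf_scale (A $ b $ a) (rotation_gen (elem_skew a b))
        + vf_scale (A $ c $ a) (rotation_gen (elem_skew a c)) + vf_scale (A $ c $ b) (rotation_gen (elem_skew b c))"
      unfolding X by (metis rotation_gen_linear(2,3))
    moreover have "rotation_gen (elem_skew a b) \<in> vf.span B" "rotation_gen (elem_skew a c) \<in> vf.span B"
      "rotation_gen (elem_skew b c) \<in> vf.span B"
      by (auto simp: B_def intro: vf.span_base)
    ultimately show "X \<in> vf.span B" by (simp only: vf.span_add vf.span_scale)
  qed
  let ?comb = "\<lambda>r s t. r *\<^sub>R elem_skew a b + s *\<^sub>R elem_skew a c + t *\<^sub>R elem_skew b c :: real^'n^'n"
  have zero: "r = 0 \<and> s = 0 \<and> t = 0" if "?comb r s t = 0" for r s t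
  proof -
    have "?comb r s t $ b $ a = 0" "?comb r s t $ c $ a = 0" "?comb r s t $ c $ b = 0"
      unfolding that by simp_all
    then show ?thesis using ne by (simp add: elem_skew_def)
  qed
  have rel: "r = 0 \<and> s = 0 \<and> t = 0" if "vf_scale r (rotation_gen (elem_skew a b))
      + vf_scale s (rotation_gen (elem_skew a c)) + vf_scale t (rotation_gen (elem_skew b c)) = 0" for r s t
    using that unfolding rotation_gen_linear(2,3)[symmetric] rotation_gen_eq_0 by (rule zero)
  have i3: "rotation_gen (elem_skew b c) \<noteq> 0"
    using rel[of 0 0 1] by (auto simp: vf.scale_zero_left)
  have i2: "rotation_gen (elem_skew a c) \<notin> vf.span {rotation_gen (elem_skew b c)}"
  proof
    assume "rotation_gen (elem_skew a c) \<in> vf.span {rotation_gen (elem_skew b c)}"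
    then obtain t where "rotation_gen (elem_skew a c) = vf_scale t (rotation_gen (elem_skew b c))"
      unfolding vf.span_singleton by blast
    then show False using rel[of 0 1 "- t"] by simp
  qed
  have i1: "rotation_gen (elem_skew a b) \<notin> vf.span {rotation_gen (elem_skew a c), rotation_gen (elem_skew b c)}"
  proof
    assume "rotation_gen (elem_skew a b) \<in> vf.span {rotation_gen (elem_skew a c), rotation_gen (elem_skew b c)}"
    then obtain s t where "rotation_gen (elem_skew a b) - vf_scale s (rotation_gen (elem_skew a c)) = vf_scale t (rotation_gen (elem_skew b c))"
      unfolding vf.span_breakdown_eq[of _ "rotation_gen (elem_skew a c)"] vf.span_singleton by blast
    then have "rotation_gen (elem_skew a b) = vf_scale t (rotation_gen (elem_skew b c)) + vf_scale s (rotation_gen (elem_skew a c))"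
      by (simp only: diff_eq_eq)
    then show False using rel[of 1 "- s" "- t"] by simp
  qed
  have n: "rotation_gen (elem_skew a c) \<noteq> rotation_gen (elem_skew b c)"
    "rotation_gen (elem_skew a b) \<notin> {rotation_gen (elem_skew a c), rotation_gen (elem_skew b c)}"
    using i2 i1 vf.span_base[of _ "{rotation_gen (elem_skew a c), rotation_gen (elem_skew b c)}"]
      vf.span_base[of _ "{rotation_gen (elem_skew b c)}"] by (metis insertI1, blast)
  show "vf.independent B"
    unfolding B_def vf.independent_insert using n i1 i2 i3
    by (simp add: vf.independent_insert vf.independent_empty)
  show "card B = 3" unfolding B_def using n by auto
qed

lemma dim_rotations:
  assumes n: "CARD('n::finite) = 2 \<or> CARD('n) = 3"
  shows "vf.dim (rotation_gen ` (so :: (real^'n^'n) set)) = CARD('n) * (CARD('n) - 1) div 2"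
  using n
proof
  assume c: "CARD('n) = 2"
  then obtain a b :: 'n where "UNIV = {a, b}" "a \<noteq> b" unfolding card_2_iff by blast
  note B = rotation_basis_2[OF this]
  show ?thesis unfolding B(1) vf.dim_span vf.dim_eq_card[OF refl B(2)] by (simp add: c)
next
  assume c: "CARD('n) = 3"
  then obtain a b c :: 'n where "UNIV = {a, b, c}" "a \<noteq> b" "b \<noteq> c" "a \<noteq> c" unfolding card_3_iff by blast
  note B = rotation_basis_3[OF this]
  show ?thesis unfolding B(1) vf.dim_span vf.dim_eq_card[OF refl B(2)] B(3) by (simp add: \<open>CARD('n) = 3\<close>)
qed

lemma perp_gen_rotation:
  assumes U: "UNIV = {a, b :: 'n::finite}" and ab: "a \<noteq> b"
  shows "perp_gen a b = rotation_gen (elem_skew a b)"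
proof -
  have all: "(\<forall>i. P i) \<longleftrightarrow> P a \<and> P b" for P using U by (metis UNIV_I insertE singletonD)
  have "elem_skew a b *v x = perp a b x" for x
    using ab by (simp add: vec_eq_iff all matrix_vector_mult_def elem_skew_def perp_def U)
  then show ?thesis by (simp add: perp_gen_def rotation_gen_def)
qed

theorem proposition1p1:
  assumes "CARD('n::finite) = 2 \<or> CARD('n) = 3"
  shows
    "{X :: 'n vfield. smooth (\<xi> X) \<and> smooth (\<eta> X) \<and> NS_symmetry X} =
       vf.span ({translation_gen \<delta> |\<delta>. \<delta> \<noteq> 0} \<union> rotation_gen ` so \<union> {scaling_gen} \<union> {pressure_gen})
     \<and> (\<forall>\<delta> :: real^'n. \<delta> \<noteq> 0 \<longrightarrow>
          generates (translation_gen \<delta>) (\<lambda>t. translate (t *\<^sub>R (\<delta> /\<^sub>R norm \<delta>))))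
     \<and> rotation_gen ` (so :: (real^'n^'n) set) =
         {X. \<exists>R :: real \<Rightarrow> real^'n^'n.
               (\<forall>t. rotation_matrix (R t)) \<and> (\<forall>s t. R (s + t) = R s ** R t) \<and>
               generates X (\<lambda>t. rotate_field (R t))}
     \<and> vf.dim (rotation_gen ` (so :: (real^'n^'n) set)) = CARD('n) * (CARD('n) - 1) div 2
     \<and> (\<forall>a b :: 'n. a \<noteq> b \<and> UNIV = {a, b} \<longrightarrow>
          rotation_gen ` (so :: (real^'n^'n) set) = vf.span {perp_gen a b})
     \<and> generates (scaling_gen :: 'n vfield) scale_field
     \<and> generates (pressure_gen :: 'n vfield) shift_pressure"
proof (intro conjI allI impI)
  have "CARD('n) \<ge> 2" using assms by auto
  then show "{X :: 'n vfield. smooth (\<xi> X) \<and> smooth (\<eta> X) \<and> NS_symmetry X} =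
       vf.span ({translation_gen \<delta> |\<delta>. \<delta> \<noteq> 0} \<union> rotation_gen ` so \<union> {scaling_gen} \<union> {pressure_gen})"
    unfolding span_generators by (rule symmetries_eq)
  show "rotation_gen ` (so :: (real^'n^'n) set) = vf.span {perp_gen a b}"
    if "a \<noteq> b \<and> UNIV = {a, b}" for a b :: 'n
    using that rotation_basis_2(1)[of a b] perp_gen_rotation[of a b] by simp
qed (rule generates_translation rotation_generators[OF assms] dim_rotations[OF assms]
    generates_scaling generates_pressure)+

end
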